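(* Let $D=\{(\boldsymbol{x}_i,y_i)\}_{i=1}^n$ be an arbitrary training set with $\boldsymbol{x}_i\in\mathbb{R}^d$, $\|\boldsymbol{x}_i\|\le1$, $y_i\in\{-1,+1\}$, with decomposition $D=D_s\cup D_c$, subspace $S$, and projection $\Pi_S$ as defined in the context. Let $\ell:\mathbb{R}\to\mathbb{R}$ be convex, strictly decreasing to $0$, and twice continuously differentiable with $\ell''>0$, and let $\mathcal{R}(\boldsymbol{w})=\frac1n\sum_{i=1}^n\ell(y_i\langle\boldsymbol{w},\boldsymbol{x}_i\rangle)$. Let $\boldsymbol{w}_0\in\mathbb{R}^d$ and $\boldsymbol{w}_{t+1}=\boldsymbol{w}_t-\eta\nabla\mathcal{R}(\boldsymbol{w}_t)$ for $t\ge 0$, where the step size $\eta>0$ satisfies $\eta\le1/(2\mathcal{R}(\boldsymbol{w}_0))$ and $$\mathcal{R}(\boldsymbol{w}_{t+1})-\mathcal{R}(\boldsymbol{w}_t)\le-\frac{\eta}{2}\|\nabla\mathcal{R}(\boldsymbol{w}_t)\|^2\quad\text{for all }t\ge0.$$ For $B>0$ let $\bar{\boldsymbol{w}}(B)\in\arg\min_{\|\boldsymbol{w}\|\le B}\mathcal{R}(\boldsymbol{w})$. Let $\bar{\boldsymbol{v}}$ be the unique minimizer over $S$ of $\mathcal{R}_s(\boldsymbol{w})=\frac1n\sum_{(\boldsymbol{x}_i,y_i)\in D_s}\ell(y_i\langle\boldsymbol{w},\boldsymbol{x}_i\rangle)$. Then: (1) $\lim_{t\to\infty}\Pi_S\boldsymbol{w}_t=\bar{\boldsymbol{v}}$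 and $\lim_{B\to\infty}\Pi_S\bar{\boldsymbol{w}}(B)=\bar{\boldsymbol{v}}$. (2) If $D_c\neq\emptyset$, then $\lim_{t\to\infty}\|\boldsymbol{w}_t\|=\lim_{B\to\infty}\|\bar{\boldsymbol{w}}(B)\|=\infty$, and $\lim_{t\to\infty}\boldsymbol{w}_t/\|\boldsymbol{w}_t\|$ exists if and only if $\lim_{B\to\infty}\bar{\boldsymbol{w}}(B)/B$ exists, and when they exist they are the same and lie in $S^\perp$.
   Context: $\|\cdot\|$ is the Euclidean norm. "Strictly decreasing to $0$" means strictly decreasing with $\lim_{z\to\infty}\ell(z)=0$. Decomposition: an example $(\boldsymbol{x}_i,y_i)$ is put into $D_c$ if there exists a unit vector $\boldsymbol{u}\in\mathbb{R}^d$ such that $y_i\langle\boldsymbol{u},\boldsymbol{x}_i\rangle>0$ and $y_j\langle\boldsymbol{u},\boldsymbol{x}_j\rangle\ge0$ for all $1\le j\le n$; otherwise it is put into $D_s$. $S:=\mathrm{span}(\{\boldsymbol{x}_i:(\boldsymbol{x}_i,y_i)\in D_s\})$, $S^\perp$ is its orthogonal complement, and $\Pi_S$ is the orthogonal projection onto $S$. It is known (Ji and Telgarsky, 2019) that if $\ell:\mathbb{R}\to\mathbb{R}$ is convex, strictly decreasing to $0$, and twice continuously differentiable with $\ell''>0$, then $\mathcal{R}_s(\boldsymbol{w})=\frac1n\sum_{(\boldsymbol{x}_i,y_i)\in D_s}\ell(y_i\langle\boldsymbol{w},\boldsymbol{x}_i\rangle)$ has compact sublevel sets over $S$, is strongly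 convex over compact subsets of $S$, and hence has a unique minimizer $\bar{\boldsymbol{v}}$ over $S$; and that there are a unit vector $\boldsymbol{u}\in S^\perp$ and $\gamma>0$ with $y_i\langle\boldsymbol{u},\boldsymbol{x}_i\rangle\ge\gamma$ for all $(\boldsymbol{x}_i,y_i)\in D_c$ (when $D_c\ne\emptyset$). When $D_c\neq\emptyset$ the infimum of $\mathcal{R}$ is not attained and $\bar{\boldsymbol{w}}(B)$ is unique; when $D_c=\emptyset$, $\bar{\boldsymbol{w}}(B)$ denotes any choice of minimizer. *)

theory Defs
  imports "HOL-Analysis.Analysis"
begin

definition gradient :: "('a::real_inner \<Rightarrow> real) \<Rightarrow> 'a \<Rightarrow> 'a" where
  "gradient f w = (THE D. GDERIV f w :> D)"

lemma gradient_eqI: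
  assumes "GDERIV f w :> D"
  shows "gradient f w = D"
proof -
  have "E = D" if "GDERIV f w :> E" for E
  proof -
    have "(\<lambda>h. inner h E) = (\<lambda>h. inner h D)"
      using that assms unfolding gderiv_def by (rule has_derivative_unique)
    then have "inner h (E - D) = 0" for h
      by (metis inner_diff_right diff_self)
    then show ?thesis
      by (metis inner_eq_zero_iff right_minus_eq)
  qed
  then show ?thesis
    unfolding gradient_def using assms by blast
qed

definition orth_proj :: "'a::euclidean_space set \<Rightarrow> 'a \<Rightarrow> 'a" where
  "orth_proj S w = (THE p. p \<in> S \<and> w - p \<in> S\<^sup>\<bottom>)"

lemma orth_proj_ex1:
  fixes S :: "'a::euclidean_space set"
  assumes "subspace S"
  shows "\<exists>!p. p \<in> S \<and> w - p \<in> S\<^sup>\<bottom>"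
proof -
  obtain y z where y: "y \<in> span S" and z: "\<And>v. v \<in> span S \<Longrightarrow> orthogonal z v" and w: "w = y + z"
    using orthogonal_subspace_decomp_exists [of S w] by blast
  have S: "span S = S"
    using assms by (simp add: span_eq_iff)
  have "w - y \<in> S\<^sup>\<bottom>"
    using z w by (auto simp: orthogonal_comp_def S orthogonal_commute)
  moreover have "p = q" if "p \<in> S" "w - p \<in> S\<^sup>\<bottom>" "q \<in> S" "w - q \<in> S\<^sup>\<bottom>" for p q
  proof -
    have "p - q \<in> S"
      using assms that by (simp add: subspace_diff)
    then have "inner (p - q) (w - p) = 0" "inner (p - q) (w - q) = 0"
      using that by (auto simp: orthogonal_comp_def orthogonal_def)
    then have "inner (p - q) (p - q) = 0"
      by (simp add: inner_diff_right)
    then show ?thesis by simp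
  qed
  ultimately show ?thesis
    using y S by blast
qed

lemma orth_proj_eqI:
  assumes "subspace S" "p \<in> S" "w - p \<in> S\<^sup>\<bottom>"
  shows "orth_proj S w = p"
  unfolding orth_proj_def using orth_proj_ex1 [OF assms(1), of w] assms(2,3) by (intro the1_equality) auto

text \<open>
  A training set of size \<open>n\<close> is a family \<open>(x i, y i)\<close> with \<open>i\<close> ranging over \<open>{1..n}\<close>, and its
  parts are represented by sets of indices.  Whether an example belongs to a part depends only on
  the pair \<open>(x i, y i)\<close>, so repeated examples always lie in the same part, and sums over a part
  count them with multiplicity.
\<close>

definition sep_part :: "nat \<Rightarrow> (nat \<Rightarrow> real ^ 'd) \<Rightarrow> (nat \<Rightarrow> real) \<Rightarrow> nat set" where
  "sep_part n x y = {i \<in> {1..n}. \<exists>u. norm u = 1 \<and> y i * inner u (x i) > 0 \<and>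
                                     (\<forall>j\<in>{1..n}. y j * inner u (x j) \<ge> 0)}"

definition nonsep_part :: "nat \<Rightarrow> (nat \<Rightarrow> real ^ 'd) \<Rightarrow> (nat \<Rightarrow> real) \<Rightarrow> nat set" where
  "nonsep_part n x y = {1..n} - sep_part n x y"

definition nonsep_span :: "nat \<Rightarrow> (nat \<Rightarrow> real ^ 'd) \<Rightarrow> (nat \<Rightarrow> real) \<Rightarrow> (real ^ 'd) set" where
  "nonsep_span n x y = span (x ` nonsep_part n x y)"

definition risk ::
  "(real \<Rightarrow> real) \<Rightarrow> nat \<Rightarrow> (nat \<Rightarrow> real ^ 'd) \<Rightarrow> (nat \<Rightarrow> real) \<Rightarrow> real ^ 'd \<Rightarrow> real" where
  "risk l n x y w = (1 / real n) * (\<Sum>i\<in>{1..n}. l (y i * inner w (x i)))"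

text \<open>The normalisation is by the size of the whole training set here as well.\<close>

definition nonsep_risk ::
  "(real \<Rightarrow> real) \<Rightarrow> nat \<Rightarrow> (nat \<Rightarrow> real ^ 'd) \<Rightarrow> (nat \<Rightarrow> real) \<Rightarrow> real ^ 'd \<Rightarrow> real" where
  "nonsep_risk l n x y w = (1 / real n) * (\<Sum>i\<in>nonsep_part n x y. l (y i * inner w (x i)))"

end

theory Submission
  imports Defs
begin

text \<open>
  Let \<open>u\<close> be orthogonal to \<open>S\<close> with margin at least \<open>\<gamma>\<close> on the separable part.  Along
  \<open>vbar + s *\<^sub>R u\<close> the risk tends to the minimum of the nonseparable risk, which is therefore the
  infimum approached both by gradient descent and by the constrained minimizers; strict convexity of
  the nonseparable risk on \<open>S\<close> then gives convergence of the projections.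

  If \<open>wbar B / B\<close> tends to \<open>q\<close>, then \<open>q\<close> has positive margins, so the point
  \<open>vbar + ((1 + e) * norm (w t - vbar)) *\<^sub>R q\<close> eventually has at most the risk of \<open>w t\<close>.  By convexity
  \<open>(1 + e) * inner (w t - vbar) q - norm (w t - vbar) - \<eta> * R (w t)\<close> is then eventually nondecreasing,
  which forces \<open>w t\<close> into the direction \<open>q\<close>.  Conversely, the iterates approach \<open>wbar B\<close>
  until their risk, and hence their norm, passes that of \<open>wbar B\<close>; on a ray in direction \<open>p\<close> this is
  only possible if \<open>wbar B / B\<close> is close to \<open>p\<close>.
\<close>

section \<open>A limit criterion in the unit ball; orthogonal projections\<close>

lemma tendsto_of_inner_ge:
  fixes f :: "'b \<Rightarrow> 'a::real_inner"
  assumes "norm q \<le> 1" and bd: "eventually (\<lambda>t. norm (f t) \<le> 1) F"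
    and inner: "\<And>e. 0 < e \<Longrightarrow> e < 1 \<Longrightarrow> eventually (\<lambda>t. inner (f t) q \<ge> 1 - e) F"
  shows "(f \<longlongrightarrow> q) F"
proof (rule tendstoI)
  fix e :: real assume e: "e > 0"
  \<comment> \<open>For two vectors of norm at most 1, an inner product of at least
    \<open>1 - d\<close> bounds the squared distance by \<open>2 * d\<close>. The quarter keeps this
    below \<open>e\<^sup>2\<close>, the bound 1/2 keeps \<open>d < 1\<close>.\<close>
  define d where "d = min (1/2) (e\<^sup>2 / 4)"
  have d: "0 < d" "d < 1" "2 * d < e\<^sup>2" using e by (auto simp: d_def min_def)
  show "eventually (\<lambda>t. dist (f t) q < e) F"
    using bd inner[OF d(1,2)]
  proof eventually_elim
    case (elim t)
    have "(norm (f t - q))\<^sup>2 = (norm (f t))\<^sup>2 + (norm q)\<^sup>2 - 2 * inner (f t) q"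
      by (simp add: power2_norm_eq_inner inner_diff_left inner_diff_right inner_commute)
    moreover have "(norm (f t))\<^sup>2 \<le> 1" "(norm q)\<^sup>2 \<le> 1"
      using elim(1) assms(1) by (auto simp: power_le_one)
    ultimately have "(norm (f t - q))\<^sup>2 < e\<^sup>2" using elim(2) d by linarith
    then show ?case using e by (simp add: dist_norm power_less_imp_less_base)
  qed
qed

lemma orth_proj_in: "subspace S \<Longrightarrow> orth_proj S w \<in> S"
  and orth_proj_diff: "subspace S \<Longrightarrow> w - orth_proj S w \<in> S\<^sup>\<bottom>"
  using theI'[OF orth_proj_ex1[of S w]] unfolding orth_proj_def by auto

section \<open>The loss function\<close>

locale margin_loss =
  fixes l l' :: "real \<Rightarrow> real"
  assumes has_deriv: "\<And>a. (l has_real_derivative l' a) (at a)"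
    and strict_mono_deriv: "strict_mono l'"
    and less: "\<And>a b. a < b \<Longrightarrow> l b < l a"
    and lim: "(l \<longlongrightarrow> 0) at_top"
begin

lemma le: "a \<le> b \<Longrightarrow> l b \<le> l a"
  using less[of a b] by (cases "a = b") auto

lemma pos: "0 < l a"
proof -
  have "eventually (\<lambda>b. l b \<le> l (a + 1)) at_top"
    using eventually_ge_at_top[of "a + 1"] by eventually_elim (rule le)
  then have "0 \<le> l (a + 1)"
    using lim by (intro tendsto_upperbound) auto
  then show ?thesis using less[of a "a + 1"] by simp
qed

lemma tangent_less:
  assumes "a \<noteq> b"
  shows "l a + l' a * (b - a) < l b"
proof (cases "a < b")
  case True
  obtain c where c: "a < c" "c < b" "l b - l a = (b - a) * l' c"
    using MVT2[OF True, of l l'] has_deriv by blast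
  have "l' a < l' c" using c strict_mono_deriv by (simp add: strict_mono_def)
  then show ?thesis using c True
    by (smt (verit) mult.commute mult_strict_left_mono)
next
  case False
  then have "b < a" using assms by simp
  then obtain c where c: "b < c" "c < a" "l a - l b = (a - b) * l' c"
    using MVT2[of b a l l'] has_deriv by blast
  have "l' c < l' a" using c strict_mono_deriv by (simp add: strict_mono_def)
  then have "(a - b) * l' c < (a - b) * l' a" using \<open>b < a\<close> by simp
  then show ?thesis using c by (simp add: algebra_simps)
qed

lemma tangent_le: "l a + l' a * (b - a) \<le> l b"
  using tangent_less[of a b] by (cases "a = b") auto

lemma deriv_neg: "l' a < 0"
  using tangent_less[of a "a + 1"] less[of a "a + 1"] by simp

lemma deriv_mono: "a \<le> b \<Longrightarrow> l' a \<le> l' b"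
  using strict_mono_deriv by (simp add: strict_mono_less_eq)

text \<open>The tangent at the midpoint lies strictly below \<open>l\<close> at both ends, and its
  two linear terms cancel in the sum.\<close>

lemma midpoint_less:
  assumes "a \<noteq> b"
  shows "2 * l ((a + b) / 2) < l a + l b"
proof -
  let ?c = "(a + b) / 2"
  have "l ?c + l' ?c * (a - ?c) < l a" "l ?c + l' ?c * (b - ?c) < l b"
    using assms by (intro tangent_less; auto)+
  moreover have "l' ?c * (a - ?c) = - (l' ?c * (b - ?c))" by (simp add: field_simps)
  ultimately show ?thesis by linarith
qed

lemma midpoint_le: "2 * l ((a + b) / 2) \<le> l a + l b"
  using midpoint_less[of a b] by (cases "a = b") auto

lemma filterlim_at_top_of_loss:
  assumes "((\<lambda>t. l (f t)) \<longlongrightarrow> 0) F"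
  shows "filterlim f at_top F"
  unfolding filterlim_at_top
proof
  fix Z
  show "eventually (\<lambda>t. Z \<le> f t) F"
    using order_tendstoD(2)[OF assms pos[of Z]]
  proof eventually_elim
    case (elim t)
    then show ?case using le[of "f t" Z] by linarith
  qed
qed

text \<open>Integrating \<open>l' s \<ge> K * l' (r * s)\<close> would give \<open>l s \<le> (K / r) * l (r * s)\<close>.\<close>

lemma deriv_scaling:
  assumes "K < r" "1 \<le> r"
  shows "\<not> eventually (\<lambda>s. K * l' (r * s) \<le> l' s) at_top"
proof
  assume "eventually (\<lambda>s. K * l' (r * s) \<le> l' s) at_top"
  then obtain s0 where s0: "\<And>s. s \<ge> s0 \<Longrightarrow> K * l' (r * s) \<le> l' s"
    by (auto simp: eventually_at_top_linorder)
  \<comment> \<open>Positivity of \<open>s\<close> gives \<open>s \<le> r * s\<close> at the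
    end.\<close>
  define s where "s = max s0 1"
  define h where "h t = l t - (K / r) * l (r * t)" for t
  have r: "r > 0" using assms by simp
  have dh: "(h has_real_derivative (l' t - K * l' (r * t))) (at t)" for t
  proof -
    have "((\<lambda>t. l (r * t)) has_real_derivative l' (r * t) * r) (at t)"
      by (rule DERIV_chain2[OF has_deriv]) (auto intro!: derivative_eq_intros)
    then have "((\<lambda>t. l t - (K / r) * l (r * t)) has_real_derivative
        (l' t - (K / r) * (l' (r * t) * r))) (at t)"
      by (intro DERIV_diff has_deriv DERIV_cmult)
    then show ?thesis using r by (simp add: h_def[abs_def])
  qed
  \<comment> \<open>A function that is nondecreasing from \<open>s\<close> on and tends to 0 is at
    most 0 at \<open>s\<close>. As \<open>K / r < 1\<close> and \<open>l\<close> is positive, this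
    gives \<open>l s < l (r * s)\<close>, against monotonicity.\<close>
  have "h s \<le> h t" if "s \<le> t" for t
    using that
  proof (rule DERIV_nonneg_imp_nondecreasing)
    fix a assume "s \<le> a" "a \<le> t"
    then show "\<exists>m. (h has_real_derivative m) (at a) \<and> 0 \<le> m"
      using dh[of a] s0[of a] by (intro exI conjI) (auto simp: s_def)
  qed
  then have "eventually (\<lambda>t. h s \<le> h t) at_top"
    by (auto simp: eventually_at_top_linorder)
  moreover have "(h \<longlongrightarrow> 0) at_top"
  proof -
    have "filterlim (\<lambda>t. r * t) at_top at_top"
      using r by (simp add: filterlim_tendsto_pos_mult_at_top[OF tendsto_const] filterlim_ident)
    then have "((\<lambda>t. l (r * t)) \<longlongrightarrow> 0) at_top"
      by (rule filterlim_compose[OF lim])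
    then have "((\<lambda>t. l t - (K / r) * l (r * t)) \<longlongrightarrow> 0 - (K / r) * 0) at_top"
      by (intro tendsto_diff lim tendsto_mult tendsto_const)
    then show ?thesis by (simp add: h_def[abs_def])
  qed
  ultimately have "h s \<le> 0" by (intro tendsto_lowerbound) auto
  then have "l s \<le> (K / r) * l (r * s)" by (simp add: h_def)
  also have "\<dots> < l (r * s)" using assms r pos[of "r * s"] by (simp add: divide_simps)
  also have "\<dots> \<le> l s"
  proof -
    have "s > 0" by (simp add: s_def)
    then have "s \<le> r * s" using assms by simp
    then show ?thesis by (rule le)
  qed
  finally show False by simp
qed

end

section \<open>The risk and its infimum\<close>

text \<open>
  \<open>z i\<close> stands for \<open>y i *\<^sub>R x i\<close>, and \<open>\<kappa>\<close> for \<open>1 / n\<close>.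
\<close>

locale split_risk = margin_loss l l' for l l' +
  fixes z :: "'i \<Rightarrow> 'a::euclidean_space" and C N :: "'i set" and \<kappa> \<gamma> :: real and u vbar :: 'a
  assumes finite: "finite C" "finite N" and disjoint: "C \<inter> N = {}"
    and z_le: "\<And>i. i \<in> C \<union> N \<Longrightarrow> norm (z i) \<le> 1"
    and \<kappa>_pos: "\<kappa> > 0" and \<gamma>_pos: "\<gamma> > 0"
    and u_le: "norm u \<le> 1"
    and u_N: "\<And>i. i \<in> N \<Longrightarrow> inner u (z i) = 0"
    and u_C: "\<And>i. i \<in> C \<Longrightarrow> \<gamma> \<le> inner u (z i)"
    and vbar_in: "vbar \<in> span (z ` N)"
    and vbar_min: "\<And>v. v \<in> span (z ` N) \<Longrightarrow>
      (\<Sum>i\<in>N. l (inner vbar (z i))) \<le> (\<Sum>i\<in>N. l (inner v (z i)))"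
begin

text \<open>The factor \<kappa> is the same for every index set, so the full risk is the sum of its
  parts over \<open>C\<close> and \<open>N\<close>.\<close>

definition partial_risk :: "'i set \<Rightarrow> 'a \<Rightarrow> real" where
  "partial_risk A w = \<kappa> * (\<Sum>i\<in>A. l (inner w (z i)))"

definition grad :: "'a \<Rightarrow> 'a" where
  "grad w = \<kappa> *\<^sub>R (\<Sum>i\<in>C \<union> N. l' (inner w (z i)) *\<^sub>R z i)"

abbreviation "R \<equiv> partial_risk (C \<union> N)"
abbreviation "S \<equiv> span (z ` N)"
abbreviation "P \<equiv> orth_proj S"

lemma risk_split: "R w = partial_risk C w + partial_risk N w"
  unfolding partial_risk_def using finite disjoint
  by (simp add: sum.union_disjoint algebra_simps)

lemma partial_risk_nonneg: "0 \<le> partial_risk A w"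
  unfolding partial_risk_def using \<kappa>_pos pos by (intro mult_nonneg_nonneg sum_nonneg) (auto intro: less_imp_le)

lemma risk_pos: "C \<noteq> {} \<Longrightarrow> 0 < partial_risk C w"
  unfolding partial_risk_def using \<kappa>_pos pos finite by (intro mult_pos_pos sum_pos) auto

lemma partial_risk_mono:
  assumes "\<And>i. i \<in> A \<Longrightarrow> inner w (z i) \<le> inner v (z i)"
  shows "partial_risk A v \<le> partial_risk A w"
  unfolding partial_risk_def by (intro mult_left_mono sum_mono le assms less_imp_le[OF \<kappa>_pos])

lemma partial_risk_cong:
  assumes "\<And>i. i \<in> A \<Longrightarrow> inner w (z i) = inner v (z i)"
  shows "partial_risk A v = partial_risk A w"
  unfolding partial_risk_def by (simp add: assms cong: sum.cong)

lemma gderiv_risk: "GDERIV R w :> grad w"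
proof -
  have *: "((\<lambda>w. l (inner w (z i))) has_derivative (\<lambda>h. inner h (l' (inner w (z i)) *\<^sub>R z i))) (at w)" for i
  proof -
    have "((\<lambda>w. inner w (z i)) has_derivative (\<lambda>h. inner h (z i))) (at w)"
      by (auto intro!: derivative_eq_intros)
    from has_derivative_compose[OF this has_deriv[unfolded has_field_derivative_def]]
    show ?thesis by (simp add: mult.commute)
  qed
  have "((\<lambda>w. \<kappa> * (\<Sum>i\<in>C \<union> N. l (inner w (z i)))) has_derivative
     (\<lambda>h. \<kappa> * (\<Sum>i\<in>C \<union> N. inner h (l' (inner w (z i)) *\<^sub>R z i)))) (at w)"
    by (intro has_derivative_mult_right has_derivative_sum *)
  then show ?thesis
    unfolding gderiv_def partial_risk_def[abs_def] grad_def
    by (simp add: inner_sum_right sum_distrib_left)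
qed

lemma inner_grad: "inner d (grad w) = \<kappa> * (\<Sum>i\<in>C \<union> N. l' (inner w (z i)) * inner d (z i))"
  by (simp add: grad_def inner_sum_right)

lemma risk_ge_tangent: "R w + inner (v - w) (grad w) \<le> R v"
proof -
  have "(\<Sum>i\<in>C \<union> N. l (inner w (z i)) + l' (inner w (z i)) * inner (v - w) (z i)) \<le> (\<Sum>i\<in>C \<union> N. l (inner v (z i)))"
    by (intro sum_mono) (simp add: inner_diff_left tangent_le)
  then show ?thesis unfolding inner_grad unfolding partial_risk_def
    using \<kappa>_pos by (simp add: sum.distrib flip: distrib_left)
qed

lemma convex_partial_risk: "convex_on UNIV (partial_risk A)"
proof (rule convex_onI)
  fix t :: real and v w :: 'a assume t: "0 < t" "t < 1"
  have cl: "l ((1 - t) * a + t * b) \<le> (1 - t) * l a + t * l b" for a b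
  proof -
    let ?c = "(1 - t) * a + t * b"
    \<comment> \<open>Tangents at the convex combination: their weighted linear terms
      cancel.\<close>
    have "(1 - t) * (l ?c + l' ?c * (a - ?c)) \<le> (1 - t) * l a" "t * (l ?c + l' ?c * (b - ?c)) \<le> t * l b"
      using t by (intro mult_left_mono tangent_le; simp)+
    then show ?thesis by (simp add: algebra_simps)
  qed
  have "(\<Sum>i\<in>A. l (inner ((1 - t) *\<^sub>R v + t *\<^sub>R w) (z i))) \<le>
     (\<Sum>i\<in>A. (1 - t) * l (inner v (z i)) + t * l (inner w (z i)))"
    by (intro sum_mono) (simp add: inner_add_left cl)
  then show "partial_risk A ((1 - t) *\<^sub>R v + t *\<^sub>R w) \<le> (1 - t) * partial_risk A v + t * partial_risk A w"
    unfolding partial_risk_def using \<kappa>_pos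
    by (simp add: sum.distrib sum_distrib_left[symmetric] mult.left_commute flip: distrib_left)
qed auto

lemma continuous_partial_risk: "continuous_on UNIV (partial_risk A)"
proof -
  have "continuous_on UNIV l" 
    using has_deriv by (blast intro: DERIV_isCont continuous_at_imp_continuous_on)
  then have "continuous_on UNIV (\<lambda>w. l (inner w (z i)))" for i
    by (rule continuous_on_compose2) (auto intro: continuous_intros)
  then show ?thesis unfolding partial_risk_def[abs_def]
    by (intro continuous_on_mult_left continuous_on_sum)
qed

section \<open>The subspace \<open>S\<close> and its orthogonal complement\<close>

lemma orth_iff: "v \<in> S\<^sup>\<bottom> \<longleftrightarrow> (\<forall>i\<in>N. inner v (z i) = 0)"
proof
  assume "v \<in> S\<^sup>\<bottom>"
  then show "\<forall>i\<in>N. inner v (z i) = 0"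
    by (auto simp: orthogonal_comp_def orthogonal_def inner_commute span_base)
next
  assume a: "\<forall>i\<in>N. inner v (z i) = 0"
  have "inner v s = 0" if "s \<in> S" for s
    using that by (induction rule: span_induct_alt) (use a in \<open>auto simp: inner_add_right\<close>)
  then show "v \<in> S\<^sup>\<bottom>" by (auto simp: orthogonal_comp_def orthogonal_def inner_commute)
qed

lemma inner_proj_N: "i \<in> N \<Longrightarrow> inner (P w) (z i) = inner w (z i)"
  using orth_proj_diff[of S w] unfolding orth_iff by (auto simp: inner_diff_left)

lemma partial_risk_proj: "partial_risk N (P w) = partial_risk N w"
  by (rule partial_risk_cong) (simp add: inner_proj_N)

lemma orth_zero: "v \<in> S \<Longrightarrow> v \<in> S\<^sup>\<bottom> \<Longrightarrow> v = 0"
  by (auto simp: orthogonal_comp_def orthogonal_self)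

lemma norm_inner_z: "i \<in> C \<union> N \<Longrightarrow> \<bar>inner v (z i)\<bar> \<le> norm v"
  using Cauchy_Schwarz_ineq2[of v "z i"] z_le[of i] mult_left_mono[of "norm (z i)" 1 "norm v"] by simp

abbreviation "infR \<equiv> partial_risk N vbar"

text \<open>The margins of \<open>w\<close> and \<open>P w\<close> on \<open>N\<close> agree, so
  minimality of \<open>vbar\<close> over \<open>S\<close> extends to the whole space. As the risk on
  \<open>C\<close> is nonnegative and \<open>risk_near_infR\<close> holds, \<open>infR\<close> is
  the infimum of \<open>R\<close>.\<close>

lemma infR_le_N: "infR \<le> partial_risk N w"
proof -
  have "infR \<le> partial_risk N (P w)"
    unfolding partial_risk_def using \<kappa>_pos orth_proj_in[of S w]
    by (intro mult_left_mono vbar_min) auto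
  then show ?thesis by (simp add: partial_risk_proj)
qed

lemma infR_le: "infR \<le> R w"
  using infR_le_N[of w] partial_risk_nonneg[of C w] by (simp add: risk_split)

lemma infR_less: "C \<noteq> {} \<Longrightarrow> infR < R w"
  using infR_le_N[of w] risk_pos[of w] by (simp add: risk_split)

text \<open>If \<open>v\<close> and \<open>vbar\<close> differed in some margin on \<open>N\<close>,
  strict convexity of \<open>l\<close> would put their midpoint below the minimum. Equal margins
  make \<open>v - vbar\<close> orthogonal to \<open>S\<close>, in which it lies.\<close>

lemma vbar_unique:
  assumes v: "v \<in> S" and le: "partial_risk N v \<le> infR"
  shows "v = vbar"
proof -
  have eq: "inner v (z i) = inner vbar (z i)" if i: "i \<in> N" for i
  proof (rule ccontr)
    assume ne: "inner v (z i) \<noteq> inner vbar (z i)"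
    let ?m = "(1/2) *\<^sub>R (v + vbar)"
    have m: "inner ?m (z j) = (inner v (z j) + inner vbar (z j)) / 2" for j
      by (simp add: inner_add_left)
    have "(\<Sum>j\<in>N. 2 * l (inner ?m (z j))) < (\<Sum>j\<in>N. l (inner v (z j)) + l (inner vbar (z j)))"
      using finite(2)
    proof (rule sum_strict_mono_ex1)
      show "\<forall>j\<in>N. 2 * l (inner ?m (z j)) \<le> l (inner v (z j)) + l (inner vbar (z j))"
        unfolding m by (simp add: midpoint_le)
      show "\<exists>j\<in>N. 2 * l (inner ?m (z j)) < l (inner v (z j)) + l (inner vbar (z j))"
        unfolding m using i ne midpoint_less by blast
    qed
    then have "\<kappa> * (2 * (\<Sum>j\<in>N. l (inner ?m (z j))))
        < \<kappa> * ((\<Sum>j\<in>N. l (inner v (z j))) + (\<Sum>j\<in>N. l (inner vbar (z j))))"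
      using \<kappa>_pos by (intro mult_strict_left_mono) (simp_all add: sum.distrib sum_distrib_left)
    then have "2 * partial_risk N ?m < partial_risk N v + infR"
      unfolding partial_risk_def by (simp add: algebra_simps)
    then show False using infR_le_N[of ?m] le by linarith
  qed
  have "v - vbar \<in> S\<^sup>\<bottom>" unfolding orth_iff using eq by (simp add: inner_diff_left)
  then have "v - vbar = 0" using v vbar_in by (intro orth_zero span_diff)
  then show ?thesis by simp
qed

text \<open>By compactness the risk on the sphere of radius \<open>e\<close> around
  \<open>vbar\<close> in \<open>S\<close> has a minimum, which exceeds \<open>infR\<close> by
  uniqueness. Convexity on the segment from \<open>vbar\<close> carries the gap to all points
  farther out.\<close>

lemma sublevel_small:
  assumes e: "0 < e"
  shows "\<exists>d>0. \<forall>v\<in>S. partial_risk N v < infR + d \<longrightarrow> norm (v - vbar) < e"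
proof -
  define K where "K = S \<inter> sphere vbar e"
  \<comment> \<open>Radial projection onto the sphere \<open>K\<close>. If \<open>K\<close> is
    empty, it shows that no point of \<open>S\<close> has distance \<open>e\<close> or more from
    \<open>vbar\<close>.\<close>
  define p where "p v = vbar + (e / norm (v - vbar)) *\<^sub>R (v - vbar)" for v
  have pK: "p v \<in> K" if "v \<in> S" "e \<le> norm (v - vbar)" for v
  proof -
    have "p v \<in> S" unfolding p_def using that vbar_in by (intro span_add span_scale span_diff)
    moreover have "dist vbar (p v) = e" using that e by (auto simp: p_def dist_norm)
    ultimately show ?thesis by (simp add: K_def)
  qed
  show ?thesis
  proof (cases "K = {}")
    case True
    then have "norm (v - vbar) < e" if "v \<in> S" for v using pK[OF that] by force
    then show ?thesis by (intro exI[of _ 1]) auto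
  next
    case False
    have "compact K" unfolding K_def
      by (simp add: closed_Int_compact closed_subspace)
    then obtain v0 where v0: "v0 \<in> K" "\<And>v. v \<in> K \<Longrightarrow> partial_risk N v0 \<le> partial_risk N v"
      using continuous_attains_inf[of K "partial_risk N"] False
        continuous_on_subset[OF continuous_partial_risk] by blast
    have "v0 \<noteq> vbar" using v0(1) e by (auto simp: K_def)
    then have d: "infR < partial_risk N v0" using vbar_unique[of v0] v0(1) by (force simp: K_def)
    have "norm (v - vbar) < e" if v: "v \<in> S" "partial_risk N v < partial_risk N v0" for v
    proof (rule ccontr)
      assume ge: "\<not> norm (v - vbar) < e"
      define t where "t = e / norm (v - vbar)"
      have t: "0 < t" "t \<le> 1" using ge e by (auto simp: t_def divide_simps)
      have "partial_risk N v0 \<le> partial_risk N (p v)" using pK v ge v0 by simp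
      also have "p v = (1 - t) *\<^sub>R vbar + t *\<^sub>R v" by (simp add: p_def t_def algebra_simps)
      also have "partial_risk N \<dots> \<le> (1 - t) * infR + t * partial_risk N v"
        using t by (intro convex_onD[OF convex_partial_risk]) auto
      also have "\<dots> < (1 - t) * partial_risk N v0 + t * partial_risk N v0"
        using t d v by (intro add_le_less_mono mult_left_mono mult_strict_left_mono) auto
      finally show False by (simp add: algebra_simps)
    qed
    then show ?thesis using d by (intro exI[of _ "partial_risk N v0 - infR"]) auto
  qed
qed

text \<open>The nonseparable risk of \<open>P (f t)\<close> lies between \<open>infR\<close> and
  \<open>R (f t)\<close>, so \<open>sublevel_small\<close> applies.\<close>

lemma proj_tendsto:
  assumes "((\<lambda>t. R (f t)) \<longlongrightarrow> infR) F"
  shows "((\<lambda>t. P (f t)) \<longlongrightarrow> vbar) F"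
proof (rule tendstoI)
  fix e :: real assume "e > 0"
  then obtain d where d: "d > 0" "\<And>v. v \<in> S \<Longrightarrow> partial_risk N v < infR + d \<Longrightarrow> norm (v - vbar) < e"
    using sublevel_small by blast
  have "eventually (\<lambda>t. R (f t) < infR + d) F"
    using order_tendstoD(2)[OF assms] d(1) by simp
  then show "eventually (\<lambda>t. dist (P (f t)) vbar < e) F"
  proof eventually_elim
    case (elim t)
    then have "partial_risk N (P (f t)) < infR + d"
      using partial_risk_nonneg[of C "f t"] by (simp add: partial_risk_proj risk_split)
    then show ?case using d(2)[of "P (f t)"] orth_proj_in[of S "f t"] by (simp add: dist_norm)
  qed
qed

text \<open>One example of \<open>C\<close> suffices: its margin is at most \<open>norm v\<close>,
  so \<kappa> times \<open>l (norm v)\<close> is at most \<open>R v - infR\<close>. A loss tending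
  to 0 forces its argument to infinity.\<close>

lemma norm_at_top:
  assumes "((\<lambda>t. R (f t)) \<longlongrightarrow> infR) F" "C \<noteq> {}"
  shows "filterlim (\<lambda>t. norm (f t)) at_top F"
proof (rule filterlim_at_top_of_loss, rule tendsto_sandwich)
  obtain i where i: "i \<in> C" using assms by blast
  show "eventually (\<lambda>t. 0 \<le> l (norm (f t))) F" using pos by (simp add: less_imp_le)
  have "l (norm v) \<le> (R v - infR) / \<kappa>" for v
  proof -
    have "l (norm v) \<le> l (inner v (z i))" using norm_inner_z[of i v] i by (intro le) auto
    also have "\<dots> \<le> (\<Sum>i\<in>C. l (inner v (z i)))"
      using finite i pos by (intro member_le_sum) (auto intro: less_imp_le)
    also have "\<dots> = partial_risk C v / \<kappa>" using \<kappa>_pos by (simp add: partial_risk_def)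
    also have "\<dots> \<le> (R v - infR) / \<kappa>"
      using infR_le_N[of v] \<kappa>_pos by (intro divide_right_mono) (auto simp: risk_split)
    finally show ?thesis .
  qed
  then show "eventually (\<lambda>t. l (norm (f t)) \<le> (R (f t) - infR) / \<kappa>) F" by simp
  have "((\<lambda>t. (R (f t) - infR) / \<kappa>) \<longlongrightarrow> (infR - infR) / \<kappa>) F"
    using assms(1) \<kappa>_pos by (intro tendsto_intros) auto
  then show "((\<lambda>t. (R (f t) - infR) / \<kappa>) \<longlongrightarrow> 0) F" by simp
qed auto

text \<open>Moving from \<open>vbar\<close> along \<open>u\<close> sends all margins on
  \<open>C\<close> to infinity and leaves those on \<open>N\<close> unchanged.\<close>

lemma risk_near_infR:
  assumes "0 < e"
  shows "\<exists>v. R v < infR + e"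
proof -
  have "((\<lambda>s. partial_risk C (vbar + s *\<^sub>R u)) \<longlongrightarrow> \<kappa> * (\<Sum>i\<in>C. 0)) at_top"
    unfolding partial_risk_def
  proof (intro tendsto_mult tendsto_const tendsto_sum)
    fix i assume i: "i \<in> C"
    have "filterlim (\<lambda>s. inner vbar (z i) + s * inner u (z i)) at_top at_top"
      using u_C[OF i] \<gamma>_pos
      by (intro filterlim_tendsto_add_at_top[OF tendsto_const]
          filterlim_at_top_mult_tendsto_pos[OF tendsto_const] filterlim_ident) auto
    then show "((\<lambda>s. l (inner (vbar + s *\<^sub>R u) (z i))) \<longlongrightarrow> 0) at_top"
      using filterlim_compose[OF lim] by (simp add: inner_add_left)
  qed
  then have "eventually (\<lambda>s. partial_risk C (vbar + s *\<^sub>R u) < e) at_top"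
    using assms by (intro order_tendstoD) auto
  then obtain s where "partial_risk C (vbar + s *\<^sub>R u) < e"
    using eventually_happens'[OF trivial_limit_at_top_linorder] by blast
  moreover have "partial_risk N (vbar + s *\<^sub>R u) = infR"
    by (rule partial_risk_cong) (simp add: inner_add_left u_N)
  ultimately show ?thesis by (intro exI[of _ "vbar + s *\<^sub>R u"]) (simp add: risk_split)
qed

text \<open>Margins on \<open>N\<close> depend only on the projection, which converges, so they
  vanish in the limit after division by \<open>s t\<close>.\<close>

lemma orth_of_proj_bounded:
  assumes "((\<lambda>t. P (f t)) \<longlongrightarrow> v) F" "filterlim s at_top F"
    and q: "((\<lambda>t. f t /\<^sub>R s t) \<longlongrightarrow> q) F" and "F \<noteq> bot"
  shows "q \<in> S\<^sup>\<bottom>"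
proof -
  have "inner q (z i) = 0" if i: "i \<in> N" for i
  proof -
    have "((\<lambda>t. inner (P (f t)) (z i) / s t) \<longlongrightarrow> 0) F"
      by (rule tendsto_divide_0[OF tendsto_inner[OF assms(1) tendsto_const]
            filterlim_at_top_imp_at_infinity[OF assms(2)]])
    moreover have "((\<lambda>t. inner (f t /\<^sub>R s t) (z i)) \<longlongrightarrow> inner q (z i)) F"
      by (intro tendsto_intros q)
    ultimately show ?thesis
      using tendsto_unique[OF assms(4)] by (simp add: inner_proj_N[OF i] divide_inverse mult.commute)
  qed
  then show ?thesis by (simp add: orth_iff)
qed

end

section \<open>The regularization path\<close>

locale regularization_path = split_risk l l' z C N \<kappa> \<gamma> u vbar
  for l l' and z :: "'i \<Rightarrow> 'a::euclidean_space" and C N \<kappa> \<gamma> u vbar +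
  fixes wbar :: "real \<Rightarrow> 'a"
  assumes wbar_norm: "\<And>B. 0 < B \<Longrightarrow> norm (wbar B) \<le> B"
    and wbar_min: "\<And>B w. 0 < B \<Longrightarrow> norm w \<le> B \<Longrightarrow>
      \<kappa> * (\<Sum>i\<in>C \<union> N. l (inner (wbar B) (z i))) \<le> \<kappa> * (\<Sum>i\<in>C \<union> N. l (inner w (z i)))"
begin

lemma risk_wbar_le: "0 < B \<Longrightarrow> norm w \<le> B \<Longrightarrow> R (wbar B) \<le> R w"
  unfolding partial_risk_def by (rule wbar_min)

lemma risk_wbar_tendsto: "((\<lambda>B. R (wbar B)) \<longlongrightarrow> infR) at_top"
proof (rule order_tendstoI)
  fix a assume "a < infR"
  then show "eventually (\<lambda>B. a < R (wbar B)) at_top"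
    using infR_le by (intro always_eventually allI) (rule less_le_trans)
next
  fix a assume "infR < a"
  then obtain v where v: "R v < a" using risk_near_infR[of "a - infR"] by auto
  show "eventually (\<lambda>B. R (wbar B) < a) at_top"
    using eventually_ge_at_top[of "max 1 (norm v)"]
  proof eventually_elim
    case (elim B)
    then show ?case using risk_wbar_le[of B v] v by simp
  qed
qed

text \<open>Variational inequality for a minimizer over a ball: a negative derivative towards
  \<open>v\<close> would give a better point on the segment, which stays in the ball.\<close>

lemma grad_wbar_nonneg:
  assumes B: "0 < B" and v: "norm v \<le> B"
  shows "0 \<le> inner (v - wbar B) (grad (wbar B))"
proof (rule ccontr)
  define d where "d = v - wbar B"
  assume neg: "\<not> 0 \<le> inner (v - wbar B) (grad (wbar B))"
  have "((\<lambda>s. R (wbar B + s *\<^sub>R d)) has_derivative (\<lambda>h. inner (h *\<^sub>R d) (grad (wbar B)))) (at 0)"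
  proof (rule has_derivative_compose[where g = R])
    show "((\<lambda>s. wbar B + s *\<^sub>R d) has_derivative (\<lambda>h. h *\<^sub>R d)) (at 0)"
      by (auto intro!: derivative_eq_intros)
    show "(R has_derivative (\<lambda>h. inner h (grad (wbar B)))) (at (wbar B + 0 *\<^sub>R d))"
      using gderiv_risk[of "wbar B"] by (simp add: gderiv_def)
  qed
  then have "((\<lambda>s. R (wbar B + s *\<^sub>R d)) has_real_derivative inner d (grad (wbar B))) (at 0)"
    by (simp add: has_field_derivative_def mult_commute_abs)
  from DERIV_neg_dec_right[OF this] neg obtain e where e: "0 < e"
      "\<And>h. 0 < h \<Longrightarrow> h < e \<Longrightarrow> R (wbar B + h *\<^sub>R d) < R (wbar B)"
    by (auto simp: d_def)
  define h where "h = min (e / 2) 1"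
  have h: "0 < h" "h < e" "h \<le> 1" using e by (auto simp: h_def min_def)
  have "wbar B + h *\<^sub>R d = (1 - h) *\<^sub>R wbar B + h *\<^sub>R v" by (simp add: d_def algebra_simps)
  also have "norm \<dots> \<le> (1 - h) * norm (wbar B) + h * norm v"
    using h by (intro norm_triangle_le) simp
  also have "\<dots> \<le> (1 - h) * B + h * B"
    using h v wbar_norm[OF B] by (intro add_mono mult_left_mono) auto
  finally have "norm (wbar B + h *\<^sub>R d) \<le> B" by (simp add: algebra_simps)
  then show False using risk_wbar_le[OF B] e(2)[OF h(1,2)] by (meson not_le)
qed

lemma proj_wbar_tendsto: "((\<lambda>B. P (wbar B)) \<longlongrightarrow> vbar) at_top"
  by (rule proj_tendsto[OF risk_wbar_tendsto])

lemma limit_norm_le: "((\<lambda>B. wbar B /\<^sub>R B) \<longlongrightarrow> q) at_top \<Longrightarrow> norm q \<le> 1"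
proof (rule tendsto_upperbound[OF tendsto_norm])
  show "eventually (\<lambda>B. norm (wbar B /\<^sub>R B) \<le> 1) at_top"
    using eventually_gt_at_top[of "0::real"]
    by eventually_elim (use wbar_norm in \<open>auto simp: divide_simps\<close>)
qed auto

text \<open>
  First-order optimality of \<open>wbar B\<close> in the direction \<open>P (wbar B) + c *\<^sub>R u - wbar B\<close>, which lies in
  the orthogonal complement of \<open>S\<close>.  If \<open>q\<close> had a nonpositive margin, it would force \<open>l'\<close> to decay
  too slowly along all large arguments.
\<close>

lemma limit_margin_pos:
  assumes q: "((\<lambda>B. wbar B /\<^sub>R B) \<longlongrightarrow> q) at_top" and i0: "i0 \<in> C"
  shows "0 < inner q (z i0)"
proof (rule ccontr)
  assume neg: "\<not> 0 < inner q (z i0)"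
  define V where "V = norm vbar + 1"
  \<comment> \<open>For large \<open>B\<close> the margins of
    \<open>P (wbar B) + (B - norm (P (wbar B))) *\<^sub>R u\<close> on \<open>C\<close> are at least
    half of \<open>\<gamma> * B\<close>, that is \<open>2 * \<delta> * B\<close>; one \<delta> of
    this remains as slack.\<close>
  define \<delta> where "\<delta> = \<gamma> / 4"
  define k where "k = real (card C)"
  define K where "K = k / \<delta>"
  \<comment> \<open>This makes the ratio of \<delta> to \<epsilon> equal to \<open>K + 1\<close>,
    the factor with which \<open>deriv_scaling\<close> is contradicted.\<close>
  define \<epsilon> where "\<epsilon> = \<delta> / (K + 1)"
  have pos': "\<delta> > 0" "K \<ge> 0" "\<epsilon> > 0" "\<epsilon> \<le> \<delta>" "k \<ge> 0"
    using \<gamma>_pos by (auto simp: \<delta>_def K_def k_def \<epsilon>_def divide_simps)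
  have V: "V > 0" unfolding V_def by (rule add_nonneg_pos) auto
  have "eventually (\<lambda>B. norm (P (wbar B)) < V) at_top"
    using order_tendstoD(2)[OF tendsto_norm[OF proj_wbar_tendsto]] by (simp add: V_def)
  moreover have "eventually (\<lambda>B. inner (wbar B /\<^sub>R B) (z i0) < \<epsilon>) at_top"
    using neg pos' by (intro order_tendstoD(2)[OF tendsto_inner[OF q tendsto_const]]) simp
  moreover have "eventually (\<lambda>B. V < B) at_top" by (rule eventually_gt_at_top)
  moreover have "eventually (\<lambda>B. 2 * (\<gamma> * V + V) / \<gamma> < B) at_top" by (rule eventually_gt_at_top)
  ultimately have "eventually (\<lambda>B. K * l' (\<delta> * B) \<le> l' (\<epsilon> * B)) at_top"
  proof eventually_elim
    case (elim B)
    define v where "v = P (wbar B)"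
    define d where "d = v + (B - norm v) *\<^sub>R u - wbar B"
    define m where "m i = inner (wbar B) (z i)" for i
    have v: "norm v < V" using elim by (simp add: v_def)
    have B: "B > 0" using elim V by simp
    \<comment> \<open>The competitor spends the remaining norm \<open>B - norm v\<close> on
      \<open>u\<close>, so it stays in the ball of radius \<open>B\<close>.\<close>
    have "norm (v + (B - norm v) *\<^sub>R u) \<le> norm v + (B - norm v) * norm u"
      using v elim by (intro norm_triangle_le) simp
    also have "\<dots> \<le> norm v + (B - norm v) * 1"
      using v elim u_le by (intro add_left_mono mult_left_mono) auto
    finally have "0 \<le> inner d (grad (wbar B))"
      unfolding d_def by (intro grad_wbar_nonneg B) simp
    also have "\<dots> = \<kappa> * ((\<Sum>i\<in>C. l' (m i) * inner d (z i)) + (\<Sum>i\<in>N. l' (m i) * inner d (z i)))"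
      unfolding inner_grad using finite disjoint by (simp add: sum.union_disjoint m_def)
    also have "(\<Sum>i\<in>N. l' (m i) * inner d (z i)) = 0"
      by (intro sum.neutral) (simp add: d_def v_def inner_diff_left inner_add_left u_N inner_proj_N)
    finally have "0 \<le> (\<Sum>i\<in>C. l' (m i) * inner d (z i))"
      using \<kappa>_pos by (simp add: zero_le_mult_iff)
    also have "\<dots> \<le> (\<Sum>i\<in>C. l' (m i) * (2 * \<delta> * B - m i))"
    proof (intro sum_mono mult_left_mono_neg less_imp_le[OF deriv_neg])
      fix i assume i: "i \<in> C"
      have "2 * \<delta> * B \<le> \<gamma> * (B - V) - V"
        using elim(4) \<gamma>_pos by (simp add: \<delta>_def field_simps)
      also have "\<dots> \<le> (B - norm v) * inner u (z i) + inner v (z i)"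
      proof -
        have "\<gamma> * (B - V) \<le> inner u (z i) * (B - norm v)"
          using u_C[OF i] \<gamma>_pos v elim by (intro mult_mono) auto
        then show ?thesis using norm_inner_z[of i v] i v by (simp add: mult.commute)
      qed
      finally show "2 * \<delta> * B - m i \<le> inner d (z i)"
        by (simp add: d_def m_def inner_diff_left inner_add_left)
    qed
    also have "\<dots> = l' (m i0) * (2 * \<delta> * B - m i0) + (\<Sum>i\<in>C - {i0}. l' (m i) * (2 * \<delta> * B - m i))"
      using finite i0 by (simp add: sum.remove)
    \<comment> \<open>The small margin of \<open>i0\<close> makes its term very negative. Another
      term can be positive only if its margin exceeds \<open>2 * \<delta> * B\<close>; there
      \<open>- l'\<close> is at most its value at \<open>\<delta> * B\<close>, and the other factor
      is at most \<open>B\<close>.\<close>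
    also have "\<dots> \<le> l' (\<epsilon> * B) * (\<delta> * B) + (\<Sum>i\<in>C - {i0}. - l' (\<delta> * B) * B)"
    proof (intro add_mono sum_mono)
      have m: "m i0 \<le> \<epsilon> * B" using elim(2) B by (simp add: m_def divide_simps)
      have "\<epsilon> * B \<le> \<delta> * B" using pos' B by simp
      then have "l' (m i0) * (2 * \<delta> * B - m i0) \<le> l' (m i0) * (\<delta> * B)"
        using m by (intro mult_left_mono_neg less_imp_le[OF deriv_neg]) linarith
      also have "\<dots> \<le> l' (\<epsilon> * B) * (\<delta> * B)"
        using m pos' B by (intro mult_right_mono deriv_mono) auto
      finally show "l' (m i0) * (2 * \<delta> * B - m i0) \<le> l' (\<epsilon> * B) * (\<delta> * B)" .
      fix i assume "i \<in> C - {i0}"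
      then have mB: "m i \<le> B"
        using norm_inner_z[of i "wbar B"] wbar_norm[OF B] by (auto simp: m_def)
      have \<delta>B: "0 < \<delta> * B" using pos' B by simp
      show "l' (m i) * (2 * \<delta> * B - m i) \<le> - l' (\<delta> * B) * B"
      proof (cases "m i \<le> 2 * \<delta> * B")
        case True
        have "l' (m i) * (2 * \<delta> * B - m i) \<le> 0"
          using True deriv_neg[of "m i"] by (intro mult_nonpos_nonneg) auto
        also have "0 \<le> - l' (\<delta> * B) * B" using deriv_neg[of "\<delta> * B"] B by (intro mult_nonneg_nonneg) auto
        finally show ?thesis .
      next
        case False
        have "(- l' (m i)) * (m i - 2 * \<delta> * B) \<le> (- l' (\<delta> * B)) * B"
          using False mB \<delta>B deriv_neg[of "\<delta> * B"] deriv_mono[of "\<delta> * B" "m i"]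
          by (intro mult_mono) auto
        then show ?thesis by (simp add: algebra_simps)
      qed
    qed
    also have "\<dots> \<le> l' (\<epsilon> * B) * (\<delta> * B) + k * (- l' (\<delta> * B) * B)"
    proof -
      have "real (card (C - {i0})) \<le> k" unfolding k_def using finite by (simp add: card_mono)
      moreover have "0 \<le> - l' (\<delta> * B) * B" using deriv_neg[of "\<delta> * B"] B by (intro mult_nonneg_nonneg) auto
      ultimately have "real (card (C - {i0})) * (- l' (\<delta> * B) * B) \<le> k * (- l' (\<delta> * B) * B)"
        by (rule mult_right_mono)
      then show ?thesis by simp
    qed
    also have "\<dots> = B * (\<delta> * l' (\<epsilon> * B) - k * l' (\<delta> * B))" by (simp add: algebra_simps)
    finally have "k * l' (\<delta> * B) \<le> \<delta> * l' (\<epsilon> * B)" using B by (simp add: zero_le_mult_iff)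
    then show "K * l' (\<delta> * B) \<le> l' (\<epsilon> * B)" using pos' by (simp add: K_def field_simps)
  qed
  then obtain B0 where B0: "\<And>B. B \<ge> B0 \<Longrightarrow> K * l' (\<delta> * B) \<le> l' (\<epsilon> * B)"
    by (auto simp: eventually_at_top_linorder)
  \<comment> \<open>Substitute \<open>s = \<epsilon> * B\<close>.\<close>
  have "K * l' ((K + 1) * s) \<le> l' s" if "s \<ge> \<epsilon> * B0" for s
  proof -
    have "s / \<epsilon> \<ge> B0" using that pos' by (simp add: field_simps)
    from B0[OF this] show ?thesis using pos' by (simp add: \<epsilon>_def mult.commute)
  qed
  then have "eventually (\<lambda>s. K * l' ((K + 1) * s) \<le> l' s) at_top"
    unfolding eventually_at_top_linorder by blast
  then show False using deriv_scaling[of K "K + 1"] pos' by simp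
qed

text \<open>The ball of radius \<open>b\<close> around \<open>vbar\<close> lies in the one of radius
  \<open>b + norm vbar\<close> around 0, where the path point has least risk. Lengthening by
  \<open>1 + a\<close> beats its margins on \<open>C\<close>, as those of \<open>q\<close> are
  positive; on \<open>N\<close> the ray attains \<open>infR\<close>, as \<open>q\<close> is
  orthogonal to \<open>S\<close>. The threshold for \<open>b\<close> is thus uniform in
  \<open>w\<close>.\<close>

lemma ray_dominates:
  assumes q: "((\<lambda>B. wbar B /\<^sub>R B) \<longlongrightarrow> q) at_top" and a: "0 < a"
  shows "eventually (\<lambda>b. \<forall>w. norm (w - vbar) \<le> b \<longrightarrow> R (vbar + ((1 + a) * b) *\<^sub>R q) \<le> R w) at_top"
proof -
  define V where "V = norm vbar"
  have shift: "filterlim (\<lambda>b. b + V) at_top at_top"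
    using filterlim_tendsto_add_at_top[OF tendsto_const[of V] filterlim_ident] by (simp add: add.commute)
  \<comment> \<open>The factor \<open>(b + V) / b\<close> changes the normalisation from
    \<open>b + V\<close> to \<open>b\<close>.\<close>
  have "((\<lambda>b. ((b + V) / b) *\<^sub>R (wbar (b + V) /\<^sub>R (b + V))) \<longlongrightarrow> 1 *\<^sub>R q) at_top"
  proof (intro tendsto_scaleR filterlim_compose[OF q shift])
    have "((\<lambda>b. 1 + V / b) \<longlongrightarrow> 1 + 0) at_top"
      by (intro tendsto_add tendsto_const tendsto_divide_0[OF tendsto_const]
          filterlim_at_top_imp_at_infinity filterlim_ident)
    moreover have "eventually (\<lambda>b. 1 + V / b = (b + V) / b) at_top"
      using eventually_gt_at_top[of 0] by eventually_elim (simp add: field_simps)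
    ultimately show "((\<lambda>b. (b + V) / b) \<longlongrightarrow> 1) at_top"
      by (simp add: tendsto_cong)
  qed
  then have lim1: "((\<lambda>b. ((b + V) / b) *\<^sub>R (wbar (b + V) /\<^sub>R (b + V))) \<longlongrightarrow> q) at_top" by simp
  have "eventually (\<lambda>b. inner (wbar (b + V)) (z i) \<le> inner (vbar + ((1 + a) * b) *\<^sub>R q) (z i)) at_top"
    if i: "i \<in> C" for i
  proof -
    \<comment> \<open>The difference of the two margins divided by \<open>b\<close>; its limit is
      \<open>a * inner q (z i)\<close>.\<close>
    have "((\<lambda>b. inner vbar (z i) / b + (1 + a) * inner q (z i) -
        inner (((b + V) / b) *\<^sub>R (wbar (b + V) /\<^sub>R (b + V))) (z i)) \<longlongrightarrow>
        0 + (1 + a) * inner q (z i) - inner q (z i)) at_top"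
      by (intro tendsto_diff tendsto_add tendsto_const tendsto_divide_0[OF tendsto_const]
          filterlim_at_top_imp_at_infinity filterlim_ident tendsto_inner lim1)
    moreover have "0 < 0 + (1 + a) * inner q (z i) - inner q (z i)"
      using limit_margin_pos[OF q i] a by (simp add: algebra_simps)
    ultimately have "eventually (\<lambda>b. 0 < inner vbar (z i) / b + (1 + a) * inner q (z i) -
        inner (((b + V) / b) *\<^sub>R (wbar (b + V) /\<^sub>R (b + V))) (z i)) at_top"
      by (rule order_tendstoD(1))
    then show ?thesis using eventually_gt_at_top[of 0]
    proof eventually_elim
      case (elim b)
      have "b + V > 0" using elim by (simp add: V_def add_pos_nonneg)
      then have "inner (((b + V) / b) *\<^sub>R (wbar (b + V) /\<^sub>R (b + V))) (z i) = inner (wbar (b + V)) (z i) / b"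
        by simp
      then have "0 < (inner vbar (z i) + (1 + a) * b * inner q (z i) - inner (wbar (b + V)) (z i)) / b"
        using elim by (simp add: diff_divide_distrib add_divide_distrib)
      then show ?case using elim by (simp add: zero_less_divide_iff inner_add_left)
    qed
  qed
  then have "eventually (\<lambda>b. \<forall>i\<in>C. inner (wbar (b + V)) (z i) \<le> inner (vbar + ((1 + a) * b) *\<^sub>R q) (z i)) at_top"
    using finite by (simp add: eventually_ball_finite)
  then show ?thesis using eventually_gt_at_top[of 0]
  proof eventually_elim
    case (elim b)
    show ?case
    proof (intro allI impI)
      fix w assume w: "norm (w - vbar) \<le> b"
      have "norm w \<le> b + V" using w norm_triangle_ineq[of "w - vbar" vbar] by (simp add: V_def)
      moreover have "b + V > 0" using elim by (simp add: V_def add_pos_nonneg)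
      ultimately have "R (wbar (b + V)) \<le> R w" by (intro risk_wbar_le)
      moreover have "partial_risk C (vbar + ((1 + a) * b) *\<^sub>R q) \<le> partial_risk C (wbar (b + V))"
        using elim by (intro partial_risk_mono) auto
      moreover have "partial_risk N (vbar + ((1 + a) * b) *\<^sub>R q) = infR"
        using orth_of_proj_bounded[OF proj_wbar_tendsto filterlim_ident q trivial_limit_at_top_linorder]
        by (intro partial_risk_cong) (auto simp: orth_iff inner_add_left)
      ultimately show "R (vbar + ((1 + a) * b) *\<^sub>R q) \<le> R w"
        using infR_le_N[of "wbar (b + V)"] by (simp add: risk_split)
    qed
  qed
qed

end

section \<open>Gradient descent\<close>

locale gradient_descent = split_risk l l' z C N \<kappa> \<gamma> u vbar
  for l l' and z :: "'i \<Rightarrow> 'a::euclidean_space" and C N \<kappa> \<gamma> u vbar +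
  fixes w :: "nat \<Rightarrow> 'a" and \<eta> :: real
  assumes \<eta>_pos: "0 < \<eta>"
    and step: "\<And>t. w (Suc t) = w t - \<eta> *\<^sub>R split_risk.grad l' z C N \<kappa> (w t)"
    and descent: "\<And>t. split_risk.partial_risk l z \<kappa> (C \<union> N) (w (Suc t))
        - split_risk.partial_risk l z \<kappa> (C \<union> N) (w t)
      \<le> - (\<eta> / 2) * (norm (split_risk.grad l' z C N \<kappa> (w t)))\<^sup>2"
begin

text \<open>The sufficient decrease in terms of step lengths. It pays for the quadratic error terms
  of later estimates.\<close>

lemma norm_step_le: "(norm (w (Suc t) - w t))\<^sup>2 \<le> 2 * \<eta> * (R (w t) - R (w (Suc t)))"
proof -
  have "2 * \<eta> * ((\<eta> / 2) * (norm (grad (w t)))\<^sup>2) \<le> 2 * \<eta> * (R (w t) - R (w (Suc t)))"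
    using descent[of t] \<eta>_pos by (intro mult_left_mono) auto
  then show ?thesis using \<eta>_pos by (simp add: step power_mult_distrib power2_eq_square mult_ac)
qed

lemma risk_decreasing: "s \<le> t \<Longrightarrow> R (w t) \<le> R (w s)"
proof (rule lift_Suc_antimono_le[of "\<lambda>t. R (w t)"])
  fix t
  have "0 \<le> 2 * \<eta> * (R (w t) - R (w (Suc t)))"
    using norm_step_le[of t] zero_le_power2 order_trans by blast
  then show "R (w (Suc t)) \<le> R (w t)" using \<eta>_pos by (simp add: zero_le_mult_iff)
qed auto

text \<open>Expanding the square, the tangent inequality bounds the cross term by
  \<open>R v - R (w t)\<close>; absorbing the squared step replaces \<open>R (w t)\<close> by the
  risk of the new iterate.\<close>

lemma dist_step: "(norm (w (Suc t) - v))\<^sup>2 \<le> (norm (w t - v))\<^sup>2 + 2 * \<eta> * (R v - R (w (Suc t)))"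
proof -
  have "(norm (w (Suc t) - v))\<^sup>2 = (norm (w t - v))\<^sup>2 + (norm (w (Suc t) - w t))\<^sup>2
      + 2 * inner (w t - v) (w (Suc t) - w t)"
    by (simp add: power2_norm_eq_inner inner_diff_left inner_diff_right inner_commute algebra_simps)
  also have "inner (w t - v) (w (Suc t) - w t) = \<eta> * inner (v - w t) (grad (w t))"
    by (simp add: step inner_diff_left algebra_simps)
  also have "\<dots> \<le> \<eta> * (R v - R (w t))"
    using risk_ge_tangent[of "w t" v] \<eta>_pos by (intro mult_left_mono) auto
  finally show ?thesis using norm_step_le[of t] by (simp add: algebra_simps)
qed

lemma risk_w_tendsto: "(\<lambda>t. R (w t)) \<longlonglongrightarrow> infR"
proof (rule order_tendstoI)
  fix a assume "a < infR"
  then show "eventually (\<lambda>t. a < R (w t)) sequentially"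
    using infR_le by (intro always_eventually allI) (rule less_le_trans)
next
  fix a assume "infR < a"
  then obtain v where v: "R v < a" using risk_near_infR[of "a - infR"] by auto
  have "\<exists>t. R (w t) < a"
  proof (rule ccontr)
    assume "\<nexists>t. R (w t) < a"
    then have ge: "a \<le> R (w t)" for t by (simp add: not_less)
    define c where "c = 2 * \<eta> * (a - R v)"
    have c: "c > 0" using v \<eta>_pos by (simp add: c_def)
    \<comment> \<open>If the risk never fell below \<open>a\<close>, every step would lower the
      squared distance to \<open>v\<close> by at least \<open>c\<close>.\<close>
    have "(norm (w t - v))\<^sup>2 + real t * c \<le> (norm (w 0 - v))\<^sup>2" for t
    proof (induction t)
      case (Suc t)
      have "2 * \<eta> * (R v - R (w (Suc t))) \<le> 2 * \<eta> * (R v - a)"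
        using ge[of "Suc t"] \<eta>_pos by (intro mult_left_mono) auto
      then have "(norm (w (Suc t) - v))\<^sup>2 \<le> (norm (w t - v))\<^sup>2 - c"
        using dist_step[of t v] by (simp add: c_def algebra_simps)
      then show ?case using Suc by (simp add: algebra_simps)
    qed simp
    moreover obtain t where "(norm (w 0 - v))\<^sup>2 < real t * c"
      using reals_Archimedean3[OF c] by blast
    ultimately show False by (smt (verit) zero_le_power2)
  qed
  then obtain T where "R (w T) < a" by blast
  then have "\<forall>t\<ge>T. R (w t) < a" using risk_decreasing[of T] by (meson le_less_trans)
  then show "eventually (\<lambda>t. R (w t) < a) sequentially" by (auto simp: eventually_sequentially)
qed

lemma dist_decreasing:
  assumes "s \<le> t" "\<And>j. j \<le> t \<Longrightarrow> R v \<le> R (w j)"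
  shows "norm (w t - v) \<le> norm (w s - v)"
  using assms
proof (induction t rule: dec_induct)
  case (step j)
  have "2 * \<eta> * (R v - R (w (Suc j))) \<le> 0"
    using step.prems[of "Suc j"] \<eta>_pos by (intro mult_nonneg_nonpos) auto
  then have "(norm (w (Suc j) - v))\<^sup>2 \<le> (norm (w j - v))\<^sup>2" using dist_step[of j v] by linarith
  then have "norm (w (Suc j) - v) \<le> norm (w j - v)" by (rule power2_le_imp_le) simp
  then show ?case using step by simp
qed simp

lemma bounded_step: "\<exists>M>0. \<forall>t. norm (w (Suc t) - w t) \<le> M"
proof -
  define X where "X = 2 * \<eta> * R (w 0)"
  have X: "X \<ge> 0" using \<eta>_pos partial_risk_nonneg by (simp add: X_def)
  have "norm (w (Suc t) - w t) \<le> 1 + X" for t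
  proof (rule power2_le_imp_le)
    have "2 * \<eta> * (R (w t) - R (w (Suc t))) \<le> 2 * \<eta> * R (w 0)"
      using risk_decreasing[of 0 t] partial_risk_nonneg[of "C \<union> N" "w (Suc t)"] \<eta>_pos
      by (intro mult_left_mono) auto
    then have "(norm (w (Suc t) - w t))\<^sup>2 \<le> X" using norm_step_le[of t] by (simp add: X_def)
    also have "\<dots> \<le> (1 + X)\<^sup>2" using X by (simp add: power2_eq_square algebra_simps)
    finally show "(norm (w (Suc t) - w t))\<^sup>2 \<le> (1 + X)\<^sup>2" .
  qed (use X in simp)
  then show ?thesis using X by (intro exI[of _ "1 + X"]) auto
qed

end

section \<open>Equivalence of the two limit directions\<close>

locale descent_and_path =
  regularization_path l l' z C N \<kappa> \<gamma> u vbar wbar + gradient_descent l l' z C N \<kappa> \<gamma> u vbar w \<eta>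
  for l l' and z :: "'i \<Rightarrow> 'a::euclidean_space" and C N \<kappa> \<gamma> u vbar wbar w \<eta> +
  assumes C_nonempty: "C \<noteq> {}"
begin

lemma norm_w_at_top: "filterlim (\<lambda>t. norm (w t)) at_top sequentially"
  by (rule norm_at_top[OF risk_w_tendsto C_nonempty])

lemma descent_follows_path:
  assumes q: "((\<lambda>B. wbar B /\<^sub>R B) \<longlongrightarrow> q) at_top"
  shows "(\<lambda>t. w t /\<^sub>R norm (w t)) \<longlonglongrightarrow> q"
proof -
  define a where "a t = norm (w t - vbar)" for t
  have "filterlim (\<lambda>t. - norm vbar + norm (w t)) at_top sequentially"
    by (rule filterlim_tendsto_add_at_top[OF tendsto_const norm_w_at_top])
  moreover have "- norm vbar + norm (w t) \<le> a t" for t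
    using norm_triangle_sub[of "w t" vbar] by (simp add: a_def)
  ultimately have a_top: "filterlim a at_top sequentially"
    by (rule filterlim_at_top_mono[OF _ always_eventually[OF allI]])
  have q1: "norm q \<le> 1" by (rule limit_norm_le[OF q])
  have dir: "(\<lambda>t. (w t - vbar) /\<^sub>R a t) \<longlonglongrightarrow> q"
  proof (rule tendsto_of_inner_ge[OF q1])
    show "eventually (\<lambda>t. norm ((w t - vbar) /\<^sub>R a t) \<le> 1) sequentially"
    proof (rule always_eventually, rule allI)
      fix t show "norm ((w t - vbar) /\<^sub>R a t) \<le> 1" by (cases "w t = vbar") (auto simp: a_def)
    qed
    fix e :: real assume e: "0 < e" "e < 1"
    have "eventually (\<lambda>t. \<forall>v. norm (v - vbar) \<le> a t \<longrightarrow> R (vbar + ((1 + e) * a t) *\<^sub>R q) \<le> R v) sequentially"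
      by (rule eventually_compose_filterlim[OF ray_dominates[OF q e(1)] a_top])
    then have "eventually (\<lambda>t. 1 \<le> a t \<and> R (vbar + ((1 + e) * a t) *\<^sub>R q) \<le> R (w t)) sequentially"
      using filterlim_at_top_dense[THEN iffD1, OF a_top, rule_format, of 1]
      by eventually_elim (auto simp: a_def)
    then obtain T where T: "\<And>t. t \<ge> T \<Longrightarrow> 1 \<le> a t"
        "\<And>t. t \<ge> T \<Longrightarrow> R (vbar + ((1 + e) * a t) *\<^sub>R q) \<le> R (w t)"
      by (auto simp: eventually_sequentially)
    \<comment> \<open>The term with \<open>R\<close> makes up for the error
      \<open>(norm d)\<^sup>2 / 2\<close> of each step.\<close>
    define pot where "pot t = (1 + e) * inner (w t - vbar) q - a t - \<eta> * R (w t)" for t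
    have pot_step: "pot t \<le> pot (Suc t)" if t: "T \<le> t" for t
    proof -
      define d where "d = w (Suc t) - w t"
      have a1: "1 \<le> a t" using T t by simp
      \<comment> \<open>The ray point has no larger risk than \<open>w t\<close>, so by convexity
        the step does not point away from it.\<close>
      have "inner (vbar + ((1 + e) * a t) *\<^sub>R q - w t) (grad (w t)) \<le> 0"
        using risk_ge_tangent[of "w t" "vbar + ((1 + e) * a t) *\<^sub>R q"] T(2)[OF t] by linarith
      moreover have "inner (vbar + ((1 + e) * a t) *\<^sub>R q - w t) d
          = - \<eta> * inner (vbar + ((1 + e) * a t) *\<^sub>R q - w t) (grad (w t))"
        by (simp add: d_def step)
      ultimately have "0 \<le> inner (vbar + ((1 + e) * a t) *\<^sub>R q - w t) d"
        using \<eta>_pos by (simp add: mult_nonneg_nonpos)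
      then have "inner (w t - vbar) d \<le> (1 + e) * a t * inner d q"
        by (simp add: inner_diff_left inner_add_left inner_commute[of q d])
      moreover have "inner (w t - vbar) d = ((a (Suc t))\<^sup>2 - (a t)\<^sup>2 - (norm d)\<^sup>2) / 2"
        by (simp add: a_def d_def power2_norm_eq_inner inner_diff_left inner_diff_right inner_commute algebra_simps)
      \<comment> \<open>Bounds \<open>a t * (a (Suc t) - a t)\<close> by half the difference of the
        squares.\<close>
      moreover have "0 \<le> (a (Suc t) - a t)\<^sup>2" by simp
      ultimately have "a t * (a (Suc t) - a t) \<le> a t * ((1 + e) * inner d q) + (norm d)\<^sup>2 / 2"
        by (simp add: power2_eq_square algebra_simps)
      also have "\<dots> \<le> a t * ((1 + e) * inner d q) + a t * ((norm d)\<^sup>2 / 2)"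
        using mult_right_mono[OF a1, of "(norm d)\<^sup>2 / 2"] by simp
      finally have "a t * (a (Suc t) - a t) \<le> a t * ((1 + e) * inner d q + (norm d)\<^sup>2 / 2)"
        by (simp add: distrib_left)
      then have "a (Suc t) - a t \<le> (1 + e) * inner d q + (norm d)\<^sup>2 / 2"
        using a1 by simp
      also have "\<dots> \<le> (1 + e) * inner d q + \<eta> * (R (w t) - R (w (Suc t)))"
        using norm_step_le[of t] by (simp add: d_def)
      finally show ?thesis by (simp add: pot_def d_def inner_diff_left algebra_simps)
    qed
    have pot_mono: "pot T \<le> pot t" if "T \<le> t" for t
      using that by (induction t rule: dec_induct) (use pot_step in \<open>auto intro: order_trans\<close>)
    have "((\<lambda>t. (1 + pot T / a t) / (1 + e)) \<longlonglongrightarrow> (1 + 0) / (1 + e))"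
      using e by (intro tendsto_divide tendsto_add tendsto_const tendsto_divide_0[OF tendsto_const]
          filterlim_at_top_imp_at_infinity a_top) auto
    moreover have "1 - e < (1 + 0) / (1 + e)"
      using e by (simp add: field_simps)
    ultimately have "eventually (\<lambda>t. 1 - e < (1 + pot T / a t) / (1 + e)) sequentially"
      by (rule order_tendstoD(1))
    then show "eventually (\<lambda>t. 1 - e \<le> inner ((w t - vbar) /\<^sub>R a t) q) sequentially"
      using eventually_ge_at_top[of T]
    proof eventually_elim
      case (elim t)
      have "0 \<le> \<eta> * R (w t)" using \<eta>_pos partial_risk_nonneg by simp
      then have "a t + pot T \<le> (1 + e) * inner (w t - vbar) q"
        using pot_mono[OF elim(2)] by (simp add: pot_def)
      then have "(a t + pot T) / (1 + e) \<le> inner (w t - vbar) q"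
        using e by (simp add: pos_divide_le_eq mult.commute)
      then have "(a t + pot T) / (1 + e) / a t \<le> inner (w t - vbar) q / a t"
        using T(1)[OF elim(2)] by (intro divide_right_mono) auto
      moreover have "(a t + pot T) / (1 + e) / a t = (1 + pot T / a t) / (1 + e)"
        using T(1)[OF elim(2)] by (simp add: add_divide_distrib)
      ultimately have "(1 + pot T / a t) / (1 + e) \<le> inner (w t - vbar) q / a t" by simp
      then show ?case using elim by (simp add: divide_inverse mult.commute)
    qed
  qed
  \<comment> \<open>It remains to replace \<open>w t - vbar\<close> by \<open>w t\<close>; the shift
    is bounded while the norms diverge.\<close>
  have "(\<lambda>t. a t / norm (w t)) \<longlonglongrightarrow> 1"
  proof (rule tendsto_sandwich)
    have *: "\<bar>a t - norm (w t)\<bar> \<le> norm vbar" for t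
      using norm_triangle_ineq3[of "w t - vbar" "w t"] by (simp add: a_def)
    have ev: "eventually (\<lambda>t. 0 < norm (w t)) sequentially"
      using filterlim_at_top_dense[THEN iffD1, OF norm_w_at_top] by blast
    show "eventually (\<lambda>t. 1 - norm vbar / norm (w t) \<le> a t / norm (w t)) sequentially"
      using ev
    proof eventually_elim
      case (elim t)
      have "(norm (w t) - norm vbar) / norm (w t) \<le> a t / norm (w t)" using *[of t] by (intro divide_right_mono) (auto simp: abs_le_iff)
      then show ?case using elim by (simp add: add_divide_distrib diff_divide_distrib)
    qed
    show "eventually (\<lambda>t. a t / norm (w t) \<le> 1 + norm vbar / norm (w t)) sequentially"
      using ev
    proof eventually_elim
      case (elim t)
      have "a t / norm (w t) \<le> (norm (w t) + norm vbar) / norm (w t)" using *[of t] by (intro divide_right_mono) (auto simp: abs_le_iff)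
      then show ?case using elim by (simp add: add_divide_distrib diff_divide_distrib)
    qed
    have z: "(\<lambda>t. norm vbar / norm (w t)) \<longlonglongrightarrow> 0"
      by (intro tendsto_divide_0[OF tendsto_const] filterlim_at_top_imp_at_infinity norm_w_at_top)
    show "(\<lambda>t. 1 - norm vbar / norm (w t)) \<longlonglongrightarrow> 1" using tendsto_diff[OF tendsto_const z, of 1] by simp
    show "(\<lambda>t. 1 + norm vbar / norm (w t)) \<longlonglongrightarrow> 1" using tendsto_add[OF tendsto_const z, of 1] by simp
  qed
  moreover have "(\<lambda>t. vbar /\<^sub>R norm (w t)) \<longlonglongrightarrow> 0"
    using tendsto_scaleR[OF tendsto_inverse_0_at_top[OF norm_w_at_top] tendsto_const[of vbar]] by simp
  ultimately have "(\<lambda>t. (a t / norm (w t)) *\<^sub>R ((w t - vbar) /\<^sub>R a t) + vbar /\<^sub>R norm (w t)) \<longlonglongrightarrow> 1 *\<^sub>R q + 0"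
    by (intro tendsto_add tendsto_scaleR dir)
  moreover have "(a t / norm (w t)) *\<^sub>R ((w t - vbar) /\<^sub>R a t) + vbar /\<^sub>R norm (w t) = w t /\<^sub>R norm (w t)" for t
    by (cases "w t = vbar") (auto simp: a_def field_simps scaleR_diff_right)
  ultimately show ?thesis by simp
qed

text \<open>
  Up to the first \<open>t\<close> with \<open>R (w t) < R (wbar B)\<close> the distance to \<open>wbar B\<close> does not increase, and
  \<open>norm (w t) > B\<close>.  The iterates stay close to the ray through \<open>p\<close>, so they cannot have passed the
  point of that ray nearest to \<open>wbar B\<close> by a large amount.
\<close>

lemma path_follows_descent:
  assumes p: "(\<lambda>t. w t /\<^sub>R norm (w t)) \<longlonglongrightarrow> p"
  shows "((\<lambda>B. wbar B /\<^sub>R B) \<longlongrightarrow> p) at_top"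
proof -
  have ev1: "eventually (\<lambda>t. 1 < norm (w t)) sequentially"
    using filterlim_at_top_dense[THEN iffD1, OF norm_w_at_top] by blast
  then have "eventually (\<lambda>t. norm (w t /\<^sub>R norm (w t)) = 1) sequentially"
    by eventually_elim (auto intro: left_inverse)
  then have "(\<lambda>t. norm (w t /\<^sub>R norm (w t))) \<longlonglongrightarrow> 1" by (rule tendsto_eventually)
  then have p1: "norm p = 1" using tendsto_norm[OF p] LIMSEQ_unique by blast
  obtain M where M: "M > 0" "\<And>t. norm (w (Suc t) - w t) \<le> M" using bounded_step by blast
  show ?thesis
  proof (rule tendsto_of_inner_ge)
    show "norm p \<le> 1" using p1 by simp
    show "eventually (\<lambda>B. norm (wbar B /\<^sub>R B) \<le> 1) at_top"
      using eventually_gt_at_top[of "0::real"]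
      by eventually_elim (use wbar_norm in \<open>auto simp: divide_simps\<close>)
    fix e :: real assume e: "0 < e" "e < 1"
    \<comment> \<open>The final comparison has factor \<open>e\<^sup>2 / 8\<close> on the left and
      \<open>2 * \<delta>\<close> on the right; this choice makes the right one half of the
      left.\<close>
    define \<delta> where "\<delta> = e\<^sup>2 / 32"
    have \<delta>: "\<delta> > 0" using e by (simp add: \<delta>_def)
    have "eventually (\<lambda>t. dist (w t /\<^sub>R norm (w t)) p < \<delta> \<and> 1 < norm (w t)) sequentially"
      using tendstoD[OF p \<delta>] ev1 by (rule eventually_conj)
    then obtain s0 where s0: "\<And>s. s \<ge> s0 \<Longrightarrow> norm (w s /\<^sub>R norm (w s) - p) < \<delta>"
        "\<And>s. s \<ge> s0 \<Longrightarrow> 1 < norm (w s)"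
      by (auto simp: eventually_sequentially dist_norm)
    have near: "norm (w s - norm (w s) *\<^sub>R p) \<le> \<delta> * norm (w s)" if "s \<ge> s0" for s
    proof -
      have "w s \<noteq> 0" using s0(2)[OF that] by auto
      then have "w s - norm (w s) *\<^sub>R p = norm (w s) *\<^sub>R (w s /\<^sub>R norm (w s) - p)"
        by (simp add: scaleR_diff_right)
      then have "norm (w s - norm (w s) *\<^sub>R p) = norm (w s) * norm (w s /\<^sub>R norm (w s) - p)" by simp
      also have "\<dots> \<le> norm (w s) * \<delta>" using s0(1)[OF that] by (intro mult_left_mono) auto
      finally show ?thesis by (simp add: mult.commute)
    qed
    define n0 where "n0 = norm (w s0)"
    have n0: "n0 > 0" using s0(2)[of s0] unfolding n0_def by linarith
    \<comment> \<open>The three thresholds place the first passage below the risk of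
      \<open>wbar B\<close> after \<open>s0\<close>, make steps small against \<open>e * B\<close>,
      and keep \<open>n0\<close> below \<open>(1 - e) * B\<close>.\<close>
    have "eventually (\<lambda>B. \<forall>j\<in>{..s0}. norm (w j) \<le> B) at_top"
      by (intro eventually_ball_finite ballI eventually_ge_at_top) auto
    moreover have "eventually (\<lambda>B. 4 * M / e \<le> B) at_top" by (rule eventually_ge_at_top)
    moreover have "eventually (\<lambda>B. n0 / (1 - e) \<le> B) at_top" by (rule eventually_ge_at_top)
    ultimately show "eventually (\<lambda>B. 1 - e \<le> inner (wbar B /\<^sub>R B) p) at_top"
      using eventually_gt_at_top[of 0]
    proof eventually_elim
      case (elim B)
      have B: "B > 0" and MB: "4 * M \<le> e * B" and n0B: "n0 \<le> (1 - e) * B"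
        using elim e by (auto simp: field_simps)
      define c where "c = inner (wbar B) p"
      have "(1 - e) * B \<le> c"
      proof (rule ccontr)
        assume "\<not> (1 - e) * B \<le> c"
        \<comment> \<open>The point of the ray nearest to \<open>wbar B\<close> has parameter
          \<open>c\<close>. Raising it to \<open>n0\<close> makes it nonnegative and ensures that
          the iterates from \<open>s0\<close> on start at norm at most \<open>k\<close>.\<close>
        define k where "k = max c n0"
        have k: "c \<le> k" "n0 \<le> k" "0 \<le> k" "k \<le> (1 - e) * B"
          using n0 n0B \<open>\<not> (1 - e) * B \<le> c\<close> by (auto simp: k_def)
        have kB: "k \<le> B - e * B" using k(4) by (simp add: algebra_simps)
        have "eventually (\<lambda>t. R (w t) < R (wbar B)) sequentially"
          by (rule order_tendstoD(2)[OF risk_w_tendsto infR_less[OF C_nonempty]])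
        then have ex: "\<exists>t. R (w t) < R (wbar B)" by (auto simp: eventually_sequentially)
        define t where "t = (LEAST t. R (w t) < R (wbar B))"
        have t: "R (w t) < R (wbar B)" unfolding t_def using ex by (rule LeastI_ex)
        have tB: "B < norm (w t)" using risk_wbar_le[OF B, of "w t"] t by (meson not_le)
        have "s0 < t"
        proof (rule ccontr)
          assume "\<not> s0 < t"
          then show False using elim(1) tB by (auto simp: not_less dest: bspec[of _ _ t])
        qed
        then obtain t' where t': "t = Suc t'" "s0 \<le> t'" by (metis Suc_le_eq less_Suc_eq_le not0_implies_Suc not_less_zero)
        have before: "R (wbar B) \<le> R (w j)" if "j \<le> t'" for j
          using not_less_Least[of j "\<lambda>t. R (w t) < R (wbar B)"] that t' by (simp add: t_def[symmetric])
        define \<rho> where "\<rho> = norm (w t')"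
        have \<rho>B: "B - M \<le> \<rho>"
          using norm_triangle_sub[of "w t" "w t'"] M(2)[of t'] tB by (simp add: t'(1) \<rho>_def)
        \<comment> \<open>The first passage of norm \<open>k\<close> after \<open>s0\<close>;
          bounded steps give a norm between \<open>k\<close> and \<open>k + M\<close>. From here to
          \<open>t'\<close> the distance to \<open>wbar B\<close> does not increase.\<close>
        define s where "s = (LEAST s. s0 \<le> s \<and> k \<le> norm (w s))"
        have kt': "s0 \<le> t' \<and> k \<le> norm (w t')"
          using t' \<rho>B kB MB M by (simp add: \<rho>_def)
        have s: "s0 \<le> s" "k \<le> norm (w s)" "s \<le> t'"
          using LeastI[of "\<lambda>s. s0 \<le> s \<and> k \<le> norm (w s)", OF kt']
            Least_le[of "\<lambda>s. s0 \<le> s \<and> k \<le> norm (w s)", OF kt'] by (auto simp: s_def)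
        define r where "r = norm (w s)"
        have r: "k \<le> r" "r \<le> k + M"
        proof -
          show "k \<le> r" using s by (simp add: r_def)
          show "r \<le> k + M"
          proof (cases "s = s0")
            case True
            then show ?thesis using k M by (simp add: r_def n0_def)
          next
            case False
            then obtain s' where s': "s = Suc s'" "s0 \<le> s'" using s(1)
              by (metis le_SucE not0_implies_Suc le_zero_eq)
            then have "norm (w s') < k"
              using not_less_Least[of s' "\<lambda>s. s0 \<le> s \<and> k \<le> norm (w s)"] by (simp add: s_def[symmetric])
            then show ?thesis
              using norm_triangle_sub[of "w s" "w s'"] M(2)[of s'] by (simp add: s'(1) r_def)
          qed
        qed
        have "norm (w t' - wbar B) \<le> norm (w s - wbar B)"
          by (rule dist_decreasing[OF s(3) before])
        then have "(norm (w t' - wbar B))\<^sup>2 \<le> (norm (w s - wbar B))\<^sup>2" by (simp add: power_mono)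
        then have sq: "\<rho>\<^sup>2 - r\<^sup>2 \<le> 2 * inner (w t') (wbar B) - 2 * inner (w s) (wbar B)"
          by (simp add: \<rho>_def r_def power2_norm_eq_inner inner_diff_left inner_diff_right inner_commute)
        have ray: "\<bar>inner (w j) (wbar B) - norm (w j) * c\<bar> \<le> \<delta> * norm (w j) * B" if "s0 \<le> j" for j
        proof -
          have "inner (w j) (wbar B) - norm (w j) * c = inner (w j - norm (w j) *\<^sub>R p) (wbar B)"
            by (simp add: c_def inner_diff_left inner_commute[of p])
          also have "\<bar>\<dots>\<bar> \<le> norm (w j - norm (w j) *\<^sub>R p) * norm (wbar B)"
            by (rule Cauchy_Schwarz_ineq2)
          also have "\<dots> \<le> (\<delta> * norm (w j)) * B"
            using near[OF that] wbar_norm[OF B] \<delta> by (intro mult_mono) auto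
          finally show ?thesis .
        qed
        have rt: "inner (w t') (wbar B) \<le> \<rho> * c + \<delta> * \<rho> * B"
          using ray[OF t'(2)] by (simp add: \<rho>_def abs_le_iff)
        have rs: "r * c - \<delta> * r * B \<le> inner (w s) (wbar B)"
          using ray[OF s(1)] by (simp add: r_def abs_le_iff)
        have h1: "e * B / 2 \<le> \<rho> - r" using \<rho>B r kB MB by simp
        have eB: "0 < e * B" using e B by simp
        \<comment> \<open>Replacing both iterates by their ray points turns \<open>sq\<close> into a
          bound for \<open>(\<rho> - r) * (\<rho> + r - 2 * k)\<close>, with error proportional to
          \<delta>. Both factors are in fact large by \<open>h1\<close> and
          \<open>h2\<close>.\<close>
        have "(\<rho> - r) * c \<le> (\<rho> - r) * k" using h1 eB k by (intro mult_left_mono) auto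
        then have "(\<rho> - r) * (\<rho> + r - 2 * k) \<le> 2 * \<delta> * (\<rho> + r) * B"
          using sq rt rs by (simp add: power2_eq_square algebra_simps)
        \<comment> \<open>Since \<open>M \<le> e * B / 4\<close>, the sum of \<rho> and
          \<open>r\<close> is at least \<open>B - e * B / 4 + k\<close>, while
          \<open>k \<le> (1 - e) * B\<close>.\<close>
        moreover have h2: "(e / 4) * (\<rho> + r) \<le> \<rho> + r - 2 * k"
        proof -
          have "k * (1 + e / 4) \<le> (1 - e) * B * (1 + e / 4)"
            using k e by (intro mult_right_mono) auto
          moreover have "(1 - e / 4) * (B - e * B / 4 + k) \<le> (1 - e / 4) * (\<rho> + r)"
            using \<rho>B r MB e by (intro mult_left_mono) auto
          moreover have "0 \<le> e * B / 4 + 5 * (e * (e * B)) / 16" using e B by simp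
          moreover have "(1 - e / 4) * (B - e * B / 4 + k) - 2 * k =
              ((1 - e) * B * (1 + e / 4) - k * (1 + e / 4)) + (e * B / 4 + 5 * (e * (e * B)) / 16)"
            by (simp add: field_simps)
          moreover have "(1 - e / 4) * (\<rho> + r) = (\<rho> + r) - (e / 4) * (\<rho> + r)"
            by (simp add: left_diff_distrib)
          ultimately show ?thesis by linarith
        qed
        have \<rho>r: "0 < \<rho> + r" using h1 eB r k by linarith
        have "(e * B / 2) * ((e / 4) * (\<rho> + r)) \<le> (\<rho> - r) * (\<rho> + r - 2 * k)"
          using h1 h2 e eB \<rho>r by (intro mult_mono) auto
        ultimately have "(e * B / 2) * ((e / 4) * (\<rho> + r)) \<le> 2 * \<delta> * (\<rho> + r) * B" by linarith
        then have "(e\<^sup>2 / 8) * ((\<rho> + r) * B) \<le> (e\<^sup>2 / 16) * ((\<rho> + r) * B)"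
          by (simp add: \<delta>_def power2_eq_square algebra_simps)
        then have "e\<^sup>2 / 8 \<le> e\<^sup>2 / 16" using \<rho>r B by simp
        then show False using e by simp
      qed
      then show ?case using B by (simp add: c_def field_simps)
    qed
  qed
qed

lemma limit_orthogonal: "((\<lambda>B. wbar B /\<^sub>R B) \<longlongrightarrow> q) at_top \<Longrightarrow> q \<in> S\<^sup>\<bottom>"
  by (rule orth_of_proj_bounded[OF proj_wbar_tendsto filterlim_ident]) auto

end

section \<open>Application to training sets\<close>

text \<open>Sum one separator for each separable example. The sum is positive on all of these and
  vanishes on the rest, since an example with positive value would itself be separable.\<close>

lemma separating_direction:
  fixes x :: "nat \<Rightarrow> real ^ 'd"
  shows "\<exists>u \<gamma>. 0 < \<gamma> \<and> norm u \<le> 1 \<and> (\<forall>i\<in>nonsep_part n x y. inner u (y i *\<^sub>R x i) = 0) \<and>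
    (\<forall>i\<in>sep_part n x y. \<gamma> \<le> inner u (y i *\<^sub>R x i))"
proof -
  let ?C = "sep_part n x y"
  have fin: "finite ?C" by (simp add: sep_part_def)
  have "\<forall>i\<in>?C. \<exists>u. 0 < y i * inner u (x i) \<and> (\<forall>j\<in>{1..n}. 0 \<le> y j * inner u (x j))"
    unfolding sep_part_def by blast
  from bchoice[OF this] obtain U
    where "\<forall>i\<in>?C. 0 < y i * inner (U i) (x i) \<and> (\<forall>j\<in>{1..n}. 0 \<le> y j * inner (U i) (x j))" ..
  then have U: "\<And>i. i \<in> ?C \<Longrightarrow> 0 < y i * inner (U i) (x i)"
      "\<And>i j. i \<in> ?C \<Longrightarrow> j \<in> {1..n} \<Longrightarrow> 0 \<le> y j * inner (U i) (x j)"
    by blast+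
  define v where "v = (\<Sum>i\<in>?C. U i)"
  have v: "y j * inner v (x j) = (\<Sum>i\<in>?C. y j * inner (U i) (x j))" for j
    by (simp add: v_def inner_sum_left sum_distrib_left)
  have ge: "0 \<le> y j * inner v (x j)" if "j \<in> {1..n}" for j
    unfolding v using U(2) that by (intro sum_nonneg) auto
  have gt: "0 < y j * inner v (x j)" if "j \<in> ?C" for j
    unfolding v using U that fin by (intro sum_pos2[of _ j]) (auto simp: sep_part_def)
  have zero: "y j * inner v (x j) = 0" if j: "j \<in> nonsep_part n x y" for j
  proof (rule ccontr)
    assume ne: "y j * inner v (x j) \<noteq> 0"
    have j1: "j \<in> {1..n}" using j by (simp add: nonsep_part_def)
    have gt0: "0 < y j * inner v (x j)" using ge[OF j1] ne by linarith
    have v0: "v \<noteq> 0" using ne by auto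
    have eq: "y i * inner (v /\<^sub>R norm v) (x i) = (y i * inner v (x i)) / norm v" for i
      by (simp add: divide_inverse)
    have "norm (v /\<^sub>R norm v) = 1 \<and> 0 < y j * inner (v /\<^sub>R norm v) (x j) \<and>
        (\<forall>i\<in>{1..n}. 0 \<le> y i * inner (v /\<^sub>R norm v) (x i))"
      unfolding eq using v0 gt0 ge by simp
    then have "j \<in> ?C" unfolding sep_part_def using j1 by blast
    then show False using j by (simp add: nonsep_part_def)
  qed
  \<comment> \<open>With no separable example \<open>v\<close> is 0, so \<open>norm v\<close> could
    not serve as divisor; the element 1 in \<open>Min\<close> covers the same case.\<close>
  define c where "c = 1 + norm v"
  define \<gamma> where "\<gamma> = Min (insert 1 ((\<lambda>i. y i * inner v (x i)) ` ?C))"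
  have c: "c > 0" "norm v \<le> c" by (simp_all add: c_def add_pos_nonneg)
  have \<gamma>: "\<gamma> > 0" unfolding \<gamma>_def using fin gt by (subst Min_gr_iff) auto
  have \<gamma>_le: "\<gamma> \<le> y i * inner v (x i)" if "i \<in> ?C" for i
    unfolding \<gamma>_def using fin that by (intro Min_le) auto
  have eq: "inner (v /\<^sub>R c) (y i *\<^sub>R x i) = (y i * inner v (x i)) / c" for i
    by (simp add: divide_inverse mult_ac)
  show ?thesis
  proof (intro exI conjI ballI)
    show "0 < \<gamma> / c" using \<gamma> c by simp
    show "norm (v /\<^sub>R c) \<le> 1" using c by (simp add: field_simps)
    show "inner (v /\<^sub>R c) (y i *\<^sub>R x i) = 0" if "i \<in> nonsep_part n x y" for i
      unfolding eq using zero[OF that] by simp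
    show "\<gamma> / c \<le> inner (v /\<^sub>R c) (y i *\<^sub>R x i)" if "i \<in> ?C" for i
      unfolding eq using \<gamma>_le[OF that] c by (intro divide_right_mono) auto
  qed
qed

theorem theorem15:
  fixes n :: nat
    and x :: "nat \<Rightarrow> real ^ 'd"
    and y :: "nat \<Rightarrow> real"
    and l :: "real \<Rightarrow> real"
    and \<eta> :: real
    and w :: "nat \<Rightarrow> real ^ 'd"
    and wbar :: "real \<Rightarrow> real ^ 'd"
    and vbar :: "real ^ 'd"
  defines "R \<equiv> risk l n x y"
    and "S \<equiv> nonsep_span n x y"
  assumes n: "n \<ge> 1"
    and x: "\<forall>i\<in>{1..n}. norm (x i) \<le> 1"
    and y: "\<forall>i\<in>{1..n}. y i \<in> {-1, 1}"
    and convex: "convex_on UNIV l"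
    and decreasing: "strict_antimono_on UNIV l"
    and lim_zero: "(l \<longlongrightarrow> 0) at_top"
    and diff1: "\<forall>z. l differentiable (at z)"
    and diff2: "\<forall>z. deriv l differentiable (at z)"
    and cont2: "continuous_on UNIV (deriv (deriv l))"
    and pos2: "\<forall>z. deriv (deriv l) z > 0"
    and gd: "\<forall>t. w (Suc t) = w t - \<eta> *\<^sub>R gradient R (w t)"
    and step_pos: "\<eta> > 0"
    and step_le: "\<eta> \<le> 1 / (2 * R (w 0))"
    and descent: "\<forall>t. R (w (Suc t)) - R (w t) \<le> - (\<eta> / 2) * (norm (gradient R (w t)))\<^sup>2"
    and wbar: "\<forall>B>0. is_arg_min R (\<lambda>w. norm w \<le> B) (wbar B)"
    and vbar: "is_arg_min (nonsep_risk l n x y) (\<lambda>v. v \<in> S) vbar"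
  shows "((\<lambda>t. orth_proj S (w t)) \<longlonglongrightarrow> vbar) \<and>
         ((\<lambda>B. orth_proj S (wbar B)) \<longlongrightarrow> vbar) at_top \<and>
         (sep_part n x y \<noteq> {} \<longrightarrow>
           filterlim (\<lambda>t. norm (w t)) at_top sequentially \<and>
           filterlim (\<lambda>B. norm (wbar B)) at_top at_top \<and>
           ((\<exists>p. (\<lambda>t. w t /\<^sub>R norm (w t)) \<longlonglongrightarrow> p) \<longleftrightarrow>
            (\<exists>q. ((\<lambda>B. wbar B /\<^sub>R B) \<longlongrightarrow> q) at_top)) \<and>
           (\<forall>p q. ((\<lambda>t. w t /\<^sub>R norm (w t)) \<longlonglongrightarrow> p) \<longrightarrow>
                  ((\<lambda>B. wbar B /\<^sub>R B) \<longlongrightarrow> q) at_top \<longrightarrow>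
                  p = q \<and> p \<in> S\<^sup>\<bottom>))"
proof -
  define z where "z i = y i *\<^sub>R x i" for i
  define C where "C = sep_part n x y"
  define N where "N = nonsep_part n x y"
  have CN: "C \<union> N = {1..n}" "C \<inter> N = {}" "finite C" "finite N"
    by (auto simp: C_def N_def nonsep_part_def sep_part_def)
  have z: "inner v (z i) = y i * inner v (x i)" for v i by (simp add: z_def)
  have R: "R v = (1 / real n) * (\<Sum>i\<in>C \<union> N. l (inner v (z i)))" for v
    by (simp add: R_def risk_def CN z)
  have Rs: "nonsep_risk l n x y v = (1 / real n) * (\<Sum>i\<in>N. l (inner v (z i)))" for v
    by (simp add: nonsep_risk_def N_def z)
  \<comment> \<open>Labels are signs, so the signed and the unsigned examples span the same
    subspace.\<close>
  have "z i \<in> span (x ` N)" "x i \<in> span (z ` N)" if i: "i \<in> N" for i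
  proof -
    show "z i \<in> span (x ` N)" unfolding z_def using i by (intro span_scale span_base) auto
    have "y i \<in> {-1, 1}" using y i CN(1) by blast
    then have "x i = y i *\<^sub>R z i" by (auto simp: z_def)
    also have "\<dots> \<in> span (z ` N)" using i by (intro span_scale span_base) auto
    finally show "x i \<in> span (z ` N)" .
  qed
  then have S: "S = span (z ` N)"
    unfolding S_def nonsep_span_def N_def[symmetric] by (subst span_eq) auto
  obtain u \<gamma> where u: "0 < \<gamma>" "norm u \<le> 1" "\<forall>i\<in>N. inner u (z i) = 0" "\<forall>i\<in>C. \<gamma> \<le> inner u (z i)"
    using separating_direction[of n x y] unfolding z_def C_def N_def by blast
  have loss: "margin_loss l (deriv l)"
  proof
    show "(l has_real_derivative deriv l a) (at a)" for a
      using diff1 by (simp add: DERIV_deriv_iff_real_differentiable)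
    show "strict_mono (deriv l)"
    proof (rule strict_monoI)
      fix a b :: real assume "a < b"
      then show "deriv l a < deriv l b"
        by (rule DERIV_pos_imp_increasing)
          (use diff2 pos2 in \<open>auto simp: DERIV_deriv_iff_real_differentiable[symmetric]\<close>)
    qed
    show "l b < l a" if "a < b" for a b
      using decreasing that by (auto simp: monotone_on_def)
    show "(l \<longlongrightarrow> 0) at_top" by (rule lim_zero)
  qed
  have split: "split_risk l (deriv l) z C N (1 / real n) \<gamma> u vbar"
  proof (intro split_risk.intro loss split_risk_axioms.intro)
    show "norm (z i) \<le> 1" if "i \<in> C \<union> N" for i
    proof -
      have "norm (x i) \<le> 1" "y i \<in> {-1, 1}" using that x y CN(1) by blast+
      then show ?thesis by (auto simp: z_def)
    qed
    show "vbar \<in> span (z ` N)" using vbar by (simp add: is_arg_min_def S)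
    show "(\<Sum>i\<in>N. l (inner vbar (z i))) \<le> (\<Sum>i\<in>N. l (inner v (z i)))" if "v \<in> span (z ` N)" for v
    proof -
      have "nonsep_risk l n x y vbar \<le> nonsep_risk l n x y v"
        using vbar that by (auto simp: is_arg_min_def S not_less)
      then show ?thesis using n by (simp add: Rs divide_le_cancel)
    qed
  qed (use CN n u in auto)
  interpret split_risk l "deriv l" z C N "1 / real n" \<gamma> u vbar by (rule split)
  have R_eq: "R = partial_risk (C \<union> N)" by (rule ext) (simp add: R partial_risk_def)
  have grad_eq: "gradient R v = grad v" for v
    unfolding R_eq by (rule gradient_eqI[OF gderiv_risk])
  have path: "regularization_path l (deriv l) z C N (1 / real n) \<gamma> u vbar wbar"
  proof (intro regularization_path.intro split regularization_path_axioms.intro)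
    fix B :: real assume B: "0 < B"
    then have w: "is_arg_min R (\<lambda>w. norm w \<le> B) (wbar B)" using wbar by blast
    show "norm (wbar B) \<le> B" using w by (simp add: is_arg_min_def)
    show "1 / real n * (\<Sum>i\<in>C \<union> N. l (inner (wbar B) (z i))) \<le> 1 / real n * (\<Sum>i\<in>C \<union> N. l (inner v (z i)))"
      if "norm v \<le> B" for v
      using w that unfolding R[symmetric] by (auto simp: is_arg_min_def not_less)
  qed
  have gd': "gradient_descent l (deriv l) z C N (1 / real n) \<gamma> u vbar w \<eta>"
  proof (intro gradient_descent.intro split gradient_descent_axioms.intro step_pos)
    show "w (Suc t) = w t - \<eta> *\<^sub>R grad (w t)" for t using gd by (simp add: grad_eq)
    show "partial_risk (C \<union> N) (w (Suc t)) - partial_risk (C \<union> N) (w t)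
        \<le> - (\<eta> / 2) * (norm (grad (w t)))\<^sup>2" for t
      using descent[rule_format, of t] unfolding grad_eq by (simp add: R_eq)
  qed
  interpret p: regularization_path l "deriv l" z C N "1 / real n" \<gamma> u vbar wbar by (rule path)
  interpret g: gradient_descent l "deriv l" z C N "1 / real n" \<gamma> u vbar w \<eta> by (rule gd')
  have "(\<lambda>t. orth_proj S (w t)) \<longlonglongrightarrow> vbar" unfolding S by (rule proj_tendsto[OF g.risk_w_tendsto])
  moreover have "((\<lambda>B. orth_proj S (wbar B)) \<longlongrightarrow> vbar) at_top" unfolding S by (rule p.proj_wbar_tendsto)
  moreover have "filterlim (\<lambda>t. norm (w t)) at_top sequentially \<and>
           filterlim (\<lambda>B. norm (wbar B)) at_top at_top \<and>
           ((\<exists>p. (\<lambda>t. w t /\<^sub>R norm (w t)) \<longlonglongrightarrow> p) \<longleftrightarrow>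
            (\<exists>q. ((\<lambda>B. wbar B /\<^sub>R B) \<longlongrightarrow> q) at_top)) \<and>
           (\<forall>p q. ((\<lambda>t. w t /\<^sub>R norm (w t)) \<longlonglongrightarrow> p) \<longrightarrow>
                  ((\<lambda>B. wbar B /\<^sub>R B) \<longlongrightarrow> q) at_top \<longrightarrow>
                  p = q \<and> p \<in> S\<^sup>\<bottom>)" if ne: "sep_part n x y \<noteq> {}"
  proof -
    have C: "C \<noteq> {}" using ne by (simp add: C_def)
    interpret dp: descent_and_path l "deriv l" z C N "1 / real n" \<gamma> u vbar wbar w \<eta>
      by (intro descent_and_path.intro path gd' descent_and_path_axioms.intro C)
    \<comment> \<open>The equivalence holds for each fixed limit, so existence on one side transfers
      to the other with the same value.\<close>
    have iff: "((\<lambda>t. w t /\<^sub>R norm (w t)) \<longlonglongrightarrow> p) \<longleftrightarrow> ((\<lambda>B. wbar B /\<^sub>R B) \<longlongrightarrow> p) at_top" for p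
      using dp.descent_follows_path dp.path_follows_descent by blast
    show ?thesis
      unfolding iff S
      using dp.norm_w_at_top norm_at_top[OF p.risk_wbar_tendsto C] dp.limit_orthogonal
        tendsto_unique[OF trivial_limit_at_top_linorder] by blast
  qed
  ultimately show ?thesis by blast
qed

end
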